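(* Let $H\in(0,1)$ and let $S^H=\{S^H_t\}_{t\ge0}$ be a subfractional Brownian motion with parameter $H$, i.e. (a continuous version of) a centered Gaussian process with covariance $$\mathbb{E}\bigl(S^H_tS^H_s\bigr)=s^{2H}+t^{2H}-\tfrac12\Bigl[(s+t)^{2H}+|s-t|^{2H}\Bigr],\qquad s,t\ge0 .$$ Then, almost surely, the path $t\mapsto S^H_t$ restricted to $I=(0,1)$ belongs to the Besov-Orlicz space $\mathcal{B}^{H}_{\Phi_2,\infty}(I)$.
   Context: Besov-Orlicz space: let $I=(0,1)$ and, for $h\in\mathbb{R}$, $I(h)=\{s\in I: s+h\in I\}$. For an interval $J\subseteq I$ and a measurable $f:J\to\mathbb{R}$ put $\|f\|_{L^{\Phi_2}(J)}=\sup_{p\ge 1}p^{-1/2}\|f\|_{L^p(J)}$, the supremum being over real $p\ge1$ (this is the exponential Orlicz norm associated with $\Phi_2(x)=e^{x^2}-1$). For $\alpha\in(0,1)$, $\mathcal{B}^{\alpha}_{\Phi_2,\infty}(I)$ is the space of measurable $f$ on $I$ with $\|f\|_{L^{\Phi_2}(I)}<\infty$ and $$\sup_{0<t\le 1}t^{-\alpha}\sup_{|h|\le t}\|f(\cdot+h)-f(\cdot)\|_{L^{\Phi_2}(I(h))}<\infty .$$ This last seminorm is equivalent to $\sup_{n\ge 1}2^{n\alpha}\|f(\cdot+2^{-n})-f(\cdot)\|_{L^{\Phi_2}(I(2^{-n}))}$, and the norm used on the space is $\|f\|_{L^{\Phi_2}(I)}+\sup_{n\ge1}2^{n\alpha}\|f(\cdot+2^{-n})-f(\cdot)\|_{L^{\Phi_2}(I(2^{-n}))}$.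 *)

theory Defs
  imports "HOL-Probability.Probability"
begin

(* The normal law with mean m and standard deviation \<sigma> \<ge> 0. The degenerate case must be
   included: the processes below satisfy Var (X 0) = 0, and a linear combination of the
   X t may vanish almost surely. *)
definition normal_law :: "real \<Rightarrow> real \<Rightarrow> real measure" where
  "normal_law m \<sigma> = (if \<sigma> = 0 then return borel m else density lborel (normal_density m \<sigma>))"

definition gaussian_rv :: "'a measure \<Rightarrow> ('a \<Rightarrow> real) \<Rightarrow> bool" where
  "gaussian_rv M Y \<longleftrightarrow>
     Y \<in> borel_measurable M \<and> (\<exists>m \<sigma>. 0 \<le> \<sigma> \<and> distr M borel Y = normal_law m \<sigma>)"

definition gaussian_process :: "'a measure \<Rightarrow> 'i set \<Rightarrow> ('i \<Rightarrow> 'a \<Rightarrow> real) \<Rightarrow> bool" where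
  "gaussian_process M T X \<longleftrightarrow>
     (\<forall>F c. finite F \<and> F \<subseteq> T \<longrightarrow> gaussian_rv M (\<lambda>\<omega>. \<Sum>t\<in>F. c t * X t \<omega>))"

(* The process is indexed by t \<ge> 0; the values X t for t < 0 are irrelevant.
   Continuity of the paths is only required almost surely. *)
definition subfractional_BM :: "'a measure \<Rightarrow> real \<Rightarrow> (real \<Rightarrow> 'a \<Rightarrow> real) \<Rightarrow> bool" where
  "subfractional_BM M H X \<longleftrightarrow>
     gaussian_process M {0..} X \<and>
     (\<forall>t\<ge>0. (\<integral>\<omega>. X t \<omega> \<partial>M) = 0) \<and>
     (\<forall>s\<ge>0. \<forall>t\<ge>0. (\<integral>\<omega>. X t \<omega> * X s \<omega> \<partial>M) =
        s powr (2 * H) + t powr (2 * H)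
          - 1 / 2 * ((s + t) powr (2 * H) + \<bar>s - t\<bar> powr (2 * H))) \<and>
     (AE \<omega> in M. continuous_on {0..} (\<lambda>t. X t \<omega>))"

(* The L^p norm on J, with value \<infinity> when f is not p-integrable; the case
   distinction is the extension of the power 1/p to \<infinity>. *)
definition Lp_norm :: "real set \<Rightarrow> real \<Rightarrow> (real \<Rightarrow> real) \<Rightarrow> ennreal" where
  "Lp_norm J p f =
     (let i = \<integral>\<^sup>+x. ennreal (\<bar>f x\<bar> powr p) \<partial>lebesgue_on J
      in if i = \<infinity> then \<infinity> else ennreal (enn2real i powr (1 / p)))"

definition Phi2_norm :: "real set \<Rightarrow> (real \<Rightarrow> real) \<Rightarrow> ennreal" where
  "Phi2_norm J f = (SUP p\<in>{1..}. ennreal (p powr (- 1 / 2)) * Lp_norm J p f)"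

definition unit_ivl :: "real set" where
  "unit_ivl = {0<..<1}"

definition shift_ivl :: "real \<Rightarrow> real set" where
  "shift_ivl h = {s \<in> unit_ivl. s + h \<in> unit_ivl}"

(* Elements are represented by total functions; only their values on (0,1) matter. *)
definition besov_orlicz :: "real \<Rightarrow> (real \<Rightarrow> real) set" where
  "besov_orlicz \<alpha> =
     {f. f \<in> borel_measurable (lebesgue_on unit_ivl) \<and>
         Phi2_norm unit_ivl f < \<infinity> \<and>
         (SUP t\<in>{0<..1}. ennreal (t powr (- \<alpha>)) *
            (SUP h\<in>{h. \<bar>h\<bar> \<le> t}. Phi2_norm (shift_ivl h) (\<lambda>s. f (s + h) - f s))) < \<infinity>}"

end

theory Submission
  imports Defs
begin

text \<open>
  Let \<open>D\<^sub>n(s) = 2\<^sup>n\<^sup>H (S(s + 2\<^sup>-\<^sup>n) - S(s))\<close> be the normalised dyadic increments of the path. The proof studies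
  the random integrals \<open>Z\<^sub>n = \<integral>\<^sub>0\<^sup>1 exp (D\<^sub>n(s)\<^sup>2/20) ds\<close> and consists of a probabilistic and a
  deterministic half.

  Almost surely \<open>sup\<^sub>n Z\<^sub>n\<close> is finite (\<open>AE_bounded_exp_energy\<close>). Each \<open>D\<^sub>n(s)\<close> is Gaussian with
  variance at most 2, so the expectations of \<open>Z\<^sub>n\<close> are bounded. This alone does not control the supremum;
  what does is that the variance of \<open>Z\<^sub>n\<close> decays geometrically, because increments far apart are
  almost uncorrelated. The covariance of two exponentials \<open>exp (U\<^sup>2/20)\<close> and \<open>exp (V\<^sup>2/20)\<close> is bounded
  by twice the absolute covariance of \<open>U\<close> and \<open>V\<close> (\<open>exp_squares_jointly_gaussian_le\<close>), and the covariance of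
  \<open>D\<^sub>n(s)\<close> and \<open>D\<^sub>n(t)\<close> consists of second differences of \<open>x powr (2 * H)\<close>, which are small once
  \<open>\<bar>s - t\<bar> \<ge> sqrt (2\<^sup>-\<^sup>n)\<close> (\<open>sfbm_increment_covariance_le\<close>). Thus the sum of the squares
  \<open>(Z\<^sub>n - E Z\<^sub>n)\<^sup>2\<close> has finite expectation and is almost surely finite.

  A continuous function whose dyadic integrals are bounded by \<open>K\<close> lies in the Besov-Orlicz space
  (\<open>besov_orlicz_if_dyadic\<close>). The binary expansion of \<open>h\<close> writes an increment over \<open>h\<close> as a convex
  combination, up to the factor \<open>C h powr H\<close>, of normalised dyadic increments, so Jensen's inequality
  bounds the exponential integral of an arbitrary increment by the same \<open>K\<close>
  (\<open>nn_integral_exp_increment_le\<close>). A bound on such an exponential integral is a bound on the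
  exponential Orlicz norm (\<open>Phi2_norm_le_if_exp_integrable\<close>).
\<close>

section \<open>Exponential moments of Gaussian variables\<close>

abbreviation gauss :: "real measure" where
  "gauss \<equiv> density lborel std_normal_density"

lemma prob_space_gauss: "prob_space gauss"
  by (rule prob_space_normal_density) simp

lemma nn_integral_exp_normal_density:
  fixes l \<sigma> :: real
  assumes "0 < \<sigma>"
  shows "(\<integral>\<^sup>+x. ennreal (exp (l * x)) \<partial>density lborel (normal_density 0 \<sigma>))
    = ennreal (exp (l\<^sup>2 * \<sigma>\<^sup>2 / 2))"
proof -
  \<comment> \<open>Completing the square turns the integrand into a shifted normal density.\<close>
  have eq: "normal_density 0 \<sigma> x * exp (l * x)
      = exp (l\<^sup>2 * \<sigma>\<^sup>2 / 2) * normal_density (l * \<sigma>\<^sup>2) \<sigma> x" for x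
  proof -
    have "-(x - 0)\<^sup>2 / (2 * \<sigma>\<^sup>2) + l * x = l\<^sup>2 * \<sigma>\<^sup>2 / 2 + -(x - l * \<sigma>\<^sup>2)\<^sup>2 / (2 * \<sigma>\<^sup>2)"
      using assms by (simp add: field_simps power2_eq_square)
    then show ?thesis
      unfolding normal_density_def by (simp add: mult_exp_exp)
  qed
  have "(\<integral>\<^sup>+x. ennreal (exp (l * x)) \<partial>density lborel (normal_density 0 \<sigma>))
      = (\<integral>\<^sup>+x. ennreal (exp (l\<^sup>2 * \<sigma>\<^sup>2 / 2)) * ennreal (normal_density (l * \<sigma>\<^sup>2) \<sigma> x) \<partial>lborel)"
    by (subst nn_integral_density) (auto simp: eq simp flip: ennreal_mult intro!: nn_integral_cong)
  also have "\<dots> = ennreal (exp (l\<^sup>2 * \<sigma>\<^sup>2 / 2))"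
    using assms by (subst nn_integral_cmult) (auto simp: nn_integral_eq_integral)
  finally show ?thesis .
qed

text \<open>
  The exponent 1/4 is below the critical value 1/2, so it fixes the constant of the domination in
  \<open>exp_quadratic_form_le\<close>.
\<close>

lemma nn_integral_exp_square_gauss:
  "(\<integral>\<^sup>+x. ennreal (exp (x\<^sup>2 / 4)) \<partial>gauss) = ennreal (sqrt 2)"
proof -
  have eq: "std_normal_density x * exp (x\<^sup>2 / 4) = sqrt 2 * normal_density 0 (sqrt 2) x" for x
  proof -
    have "std_normal_density x * exp (x\<^sup>2 / 4) = 1 / sqrt (2 * pi) * exp (- x\<^sup>2 / 4)"
      unfolding std_normal_density_def by (simp add: mult_exp_exp)
    also have "\<dots> = sqrt 2 * normal_density 0 (sqrt 2) x"
      unfolding normal_density_def by (simp add: real_sqrt_mult field_simps)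
    finally show ?thesis .
  qed
  have "(\<integral>\<^sup>+x. ennreal (exp (x\<^sup>2 / 4)) \<partial>gauss)
      = (\<integral>\<^sup>+x. ennreal (sqrt 2) * ennreal (normal_density 0 (sqrt 2) x) \<partial>lborel)"
    by (subst nn_integral_density) (auto simp: eq simp flip: ennreal_mult intro!: nn_integral_cong)
  also have "\<dots> = ennreal (sqrt 2)"
    by (subst nn_integral_cmult) (auto simp: nn_integral_eq_integral)
  finally show ?thesis .
qed

lemma nn_integral_exp_gauss:
  "(\<integral>\<^sup>+x. ennreal (exp (l * x)) \<partial>gauss) = ennreal (exp (l\<^sup>2 / 2))"
  using nn_integral_exp_normal_density[of 1 l] by simp

lemma (in prob_space) centered_gaussian:
  assumes "gaussian_rv M Y" and "expectation Y = 0"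
  shows "integrable M (\<lambda>\<omega>. (Y \<omega>)\<^sup>2)"
    and "(\<integral>\<^sup>+\<omega>. ennreal (exp (Y \<omega>)) \<partial>M) = ennreal (exp (expectation (\<lambda>\<omega>. (Y \<omega>)\<^sup>2) / 2))"
proof -
  obtain m \<sigma> where Y[measurable]: "Y \<in> borel_measurable M" and \<sigma>: "0 \<le> \<sigma>"
    and d: "distr M borel Y = normal_law m \<sigma>"
    using assms(1) unfolding gaussian_rv_def by blast
  have *: "integrable M (\<lambda>\<omega>. (Y \<omega>)\<^sup>2) \<and>
    (\<integral>\<^sup>+\<omega>. ennreal (exp (Y \<omega>)) \<partial>M) = ennreal (exp (expectation (\<lambda>\<omega>. (Y \<omega>)\<^sup>2) / 2))"
  proof (cases "\<sigma> = 0")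
    case True
    then have d': "distr M borel Y = return borel m"
      using d by (simp add: normal_law_def)
    have "AE y in distr M borel Y. y = m"
      unfolding d' by (subst AE_return) auto
    then have ae: "AE \<omega> in M. Y \<omega> = m"
      by (subst (asm) AE_distr_iff) auto
    have "expectation Y = (\<integral>\<omega>. m \<partial>M)"
      by (rule integral_cong_AE) (use ae in auto)
    then have "m = 0"
      using assms(2) by (simp add: prob_space)
    then have ae: "AE \<omega> in M. Y \<omega> = 0" using ae by simp
    have 1: "expectation (\<lambda>\<omega>. (Y \<omega>)\<^sup>2) = (\<integral>\<omega>. 0 \<partial>M)"
      by (rule integral_cong_AE) (use ae in auto)
    have 2: "integrable M (\<lambda>\<omega>. (Y \<omega>)\<^sup>2) = integrable M (\<lambda>\<omega>. 0::real)"
      by (rule integrable_cong_AE) (use ae in auto)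
    have 3: "(\<integral>\<^sup>+\<omega>. ennreal (exp (Y \<omega>)) \<partial>M) = (\<integral>\<^sup>+\<omega>. 1 \<partial>M)"
      by (rule nn_integral_cong_AE) (use ae in auto)
    show ?thesis using 1 2 3 by (simp add: emeasure_space_1)
  next
    case False
    then have s: "0 < \<sigma>" using \<sigma> by simp
    have d': "distr M borel Y = density lborel (normal_density m \<sigma>)"
      using d False by (simp add: normal_law_def)
    have D: "distributed M lborel Y (normal_density m \<sigma>)"
      unfolding distributed_def
      using d' by (auto cong: distr_cong)
    have m: "m = 0"
      using normal_distributed_expectation[OF s D] assms(2) by simp
    have v: "expectation (\<lambda>\<omega>. (Y \<omega>)\<^sup>2) = \<sigma>\<^sup>2"
      using normal_distributed_variance[OF s D] assms(2) by simp
    have i: "integrable M (\<lambda>\<omega>. (Y \<omega>)\<^sup>2)"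
      using v s not_integrable_integral_eq by fastforce
    have "(\<integral>\<^sup>+\<omega>. ennreal (exp (Y \<omega>)) \<partial>M) = (\<integral>\<^sup>+y. ennreal (exp (1 * y)) \<partial>distr M borel Y)"
      by (subst nn_integral_distr) auto
    also have "\<dots> = ennreal (exp (\<sigma>\<^sup>2 / 2))"
      unfolding d' m by (subst nn_integral_exp_normal_density[OF s]) simp
    finally show ?thesis using v i by simp
  qed
  then show "integrable M (\<lambda>\<omega>. (Y \<omega>)\<^sup>2)"
    "(\<integral>\<^sup>+\<omega>. ennreal (exp (Y \<omega>)) \<partial>M) = ennreal (exp (expectation (\<lambda>\<omega>. (Y \<omega>)\<^sup>2) / 2))" by auto
qed

lemma integrable_mult_if_squares:
  fixes U V :: "'a \<Rightarrow> real"
  assumes [measurable]: "U \<in> borel_measurable M" "V \<in> borel_measurable M"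
    and "integrable M (\<lambda>\<omega>. (U \<omega>)\<^sup>2)" "integrable M (\<lambda>\<omega>. (V \<omega>)\<^sup>2)"
  shows "integrable M (\<lambda>\<omega>. U \<omega> * V \<omega>)"
proof (rule Bochner_Integration.integrable_bound)
  show "integrable M (\<lambda>\<omega>. (U \<omega>)\<^sup>2 + (V \<omega>)\<^sup>2)" using assms by simp
  have "\<bar>u * v\<bar> \<le> u\<^sup>2 + v\<^sup>2" for u v :: real
  proof -
    have "0 \<le> \<bar>u\<bar> * \<bar>v\<bar>" by simp
    then show ?thesis
      using sum_squares_bound[of "\<bar>u\<bar>" "\<bar>v\<bar>"] unfolding abs_mult power2_abs by linarith
  qed
  then show "AE \<omega> in M. norm (U \<omega> * V \<omega>) \<le> norm ((U \<omega>)\<^sup>2 + (V \<omega>)\<^sup>2)"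
    by simp
qed simp

text \<open>
  The left-hand side is the joint exponential moment of two Gaussian variables with variances
  \<open>a\<close>, \<open>b\<close> and covariance \<open>r\<close>, before integration over two independent standard normal variables
  \<open>x\<close>, \<open>y\<close>; for \<open>r = 0\<close> it factorises. The error is linear in \<open>r\<close> because
  \<open>exp z - 1 \<le> \<bar>z\<bar> exp \<bar>z\<bar>\<close>, and the scale 1/20 is small enough that the remaining exponentials
  are all absorbed by the integrable function \<open>exp (x\<^sup>2/4) exp (y\<^sup>2/4)\<close>.
\<close>

lemma exp_quadratic_form_le:
  fixes a b r x y :: real
  assumes "a \<le> 2" "b \<le> 2" "\<bar>r\<bar> \<le> 2"
  shows "exp ((a * x\<^sup>2 + 2 * r * x * y + b * y\<^sup>2) / 20)
    \<le> exp ((a * x\<^sup>2 + b * y\<^sup>2) / 20) + \<bar>r\<bar> * (exp (x\<^sup>2 / 4) * exp (y\<^sup>2 / 4))"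
proof -
  define q where "q = x\<^sup>2 + y\<^sup>2"
  have q0: "0 \<le> q" by (simp add: q_def)
  have xy: "2 * \<bar>x * y\<bar> \<le> q"
    using sum_squares_bound[of "\<bar>x\<bar>" "\<bar>y\<bar>"] by (simp add: q_def abs_mult)
  have e1: "exp z - 1 \<le> \<bar>z\<bar> * exp \<bar>z\<bar>" for z :: real
  proof -
    have "1 - \<bar>z\<bar> \<le> exp (- \<bar>z\<bar>)" using exp_ge_add_one_self[of "- \<bar>z\<bar>"] by simp
    then have "(1 - \<bar>z\<bar>) * exp \<bar>z\<bar> \<le> exp (- \<bar>z\<bar>) * exp \<bar>z\<bar>" by (rule mult_right_mono) simp
    then have "exp \<bar>z\<bar> - 1 \<le> \<bar>z\<bar> * exp \<bar>z\<bar>" by (simp add: mult_exp_exp algebra_simps)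
    moreover have "exp z \<le> exp \<bar>z\<bar>" by simp
    ultimately show ?thesis by linarith
  qed
  define z where "z = r * (x * y) / 10"
  have z1: "\<bar>z\<bar> \<le> \<bar>r\<bar> * (q / 20)"
  proof -
    have "\<bar>z\<bar> = \<bar>r\<bar> * (2 * \<bar>x * y\<bar>) / 20" by (simp add: z_def abs_mult)
    also have "\<dots> \<le> \<bar>r\<bar> * q / 20" using xy by (intro divide_right_mono mult_left_mono) auto
    finally show ?thesis by simp
  qed
  have z2: "\<bar>z\<bar> \<le> q / 10"
  proof -
    have "\<bar>r\<bar> * (q / 20) \<le> 2 * (q / 20)" using assms(3) q0 by (intro mult_right_mono) auto
    then show ?thesis using z1 by linarith
  qed
  have ab: "(a * x\<^sup>2 + b * y\<^sup>2) / 20 \<le> q / 10"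
    using mult_right_mono[OF assms(1), of "x\<^sup>2"] mult_right_mono[OF assms(2), of "y\<^sup>2"]
    by (simp add: q_def)
  have "exp ((a * x\<^sup>2 + 2 * r * x * y + b * y\<^sup>2) / 20)
      = exp ((a * x\<^sup>2 + b * y\<^sup>2) / 20) * exp z"
    by (simp add: mult_exp_exp z_def field_simps)
  also have "\<dots> = exp ((a * x\<^sup>2 + b * y\<^sup>2) / 20) + exp ((a * x\<^sup>2 + b * y\<^sup>2) / 20) * (exp z - 1)"
    by (simp add: algebra_simps)
  also have "exp ((a * x\<^sup>2 + b * y\<^sup>2) / 20) * (exp z - 1) \<le> exp (q / 10) * (\<bar>z\<bar> * exp \<bar>z\<bar>)"
  proof -
    have "exp ((a * x\<^sup>2 + b * y\<^sup>2) / 20) * (exp z - 1)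
        \<le> exp ((a * x\<^sup>2 + b * y\<^sup>2) / 20) * (\<bar>z\<bar> * exp \<bar>z\<bar>)"
      using e1[of z] by (intro mult_left_mono) auto
    also have "\<dots> \<le> exp (q / 10) * (\<bar>z\<bar> * exp \<bar>z\<bar>)"
      using ab by (intro mult_right_mono) auto
    finally show ?thesis .
  qed
  also have "exp (q / 10) * (\<bar>z\<bar> * exp \<bar>z\<bar>)
      \<le> exp (q / 10) * ((\<bar>r\<bar> * exp (q / 20)) * exp (q / 10))"
  proof -
    have "q / 20 \<le> exp (q / 20)" using exp_ge_add_one_self[of "q / 20"] by linarith
    then have "\<bar>r\<bar> * (q / 20) \<le> \<bar>r\<bar> * exp (q / 20)" by (intro mult_left_mono) auto
    then show ?thesis
      using z1 z2 by (intro mult_left_mono mult_mono) auto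
  qed
  also have "\<dots> = \<bar>r\<bar> * (exp (x\<^sup>2 / 4) * exp (y\<^sup>2 / 4))"
    by (simp add: mult_exp_exp q_def field_simps)
  finally show ?thesis by simp
qed

text \<open>
  A squared exponential is a mixture of linear ones: \<open>exp (u\<^sup>2/20)\<close> is the average of
  \<open>exp (k u x)\<close> over a standard normal \<open>x\<close>, where \<open>k\<^sup>2 = 1/10\<close>. By Fubini only the moment generating
  function of a centered Gaussian variable is needed, and a vanishing variance is no special case.
\<close>

lemma (in prob_space) exp_square_gaussian:
  assumes "\<And>x. gaussian_rv M (\<lambda>\<omega>. x * U \<omega>)" and "expectation U = 0"
  shows "(\<integral>\<^sup>+\<omega>. ennreal (exp ((U \<omega>)\<^sup>2 / 20)) \<partial>M)
    = (\<integral>\<^sup>+x. ennreal (exp (expectation (\<lambda>\<omega>. (U \<omega>)\<^sup>2) * x\<^sup>2 / 20)) \<partial>gauss)"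
proof -
  interpret G: prob_space gauss by (rule prob_space_gauss)
  interpret pair_sigma_finite M gauss ..
  have [measurable]: "U \<in> borel_measurable M"
    using assms(1)[of 1] by (simp add: gaussian_rv_def)
  define k :: real where "k = sqrt (1 / 10)"
  have k: "k\<^sup>2 = 1 / 10" by (simp add: k_def)
  have "(\<integral>\<^sup>+\<omega>. ennreal (exp ((U \<omega>)\<^sup>2 / 20)) \<partial>M)
      = (\<integral>\<^sup>+\<omega>. (\<integral>\<^sup>+x. ennreal (exp ((k * U \<omega>) * x)) \<partial>gauss) \<partial>M)"
    by (subst nn_integral_exp_gauss) (simp add: power_mult_distrib k)
  also have "\<dots> = (\<integral>\<^sup>+x. (\<integral>\<^sup>+\<omega>. ennreal (exp ((k * U \<omega>) * x)) \<partial>M) \<partial>gauss)"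
    by (rule Fubini'[symmetric]) measurable
  also have "\<dots> = (\<integral>\<^sup>+x. ennreal (exp (expectation (\<lambda>\<omega>. (U \<omega>)\<^sup>2) * x\<^sup>2 / 20)) \<partial>gauss)"
  proof (rule nn_integral_cong)
    fix x :: real
    have "(\<integral>\<^sup>+\<omega>. ennreal (exp ((k * U \<omega>) * x)) \<partial>M) = (\<integral>\<^sup>+\<omega>. ennreal (exp ((k * x) * U \<omega>)) \<partial>M)"
      by (simp add: ac_simps)
    also have "\<dots> = ennreal (exp (expectation (\<lambda>\<omega>. ((k * x) * U \<omega>)\<^sup>2) / 2))"
      using assms by (intro centered_gaussian) auto
    finally show "(\<integral>\<^sup>+\<omega>. ennreal (exp ((k * U \<omega>) * x)) \<partial>M)
        = ennreal (exp (expectation (\<lambda>\<omega>. (U \<omega>)\<^sup>2) * x\<^sup>2 / 20))"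
      by (simp add: power_mult_distrib k mult.commute)
  qed
  finally show ?thesis .
qed

lemma (in prob_space) exp_square_gaussian_le:
  assumes "\<And>x. gaussian_rv M (\<lambda>\<omega>. x * U \<omega>)" and "expectation U = 0"
    and "expectation (\<lambda>\<omega>. (U \<omega>)\<^sup>2) \<le> 2"
  shows "(\<integral>\<^sup>+\<omega>. ennreal (exp ((U \<omega>)\<^sup>2 / 20)) \<partial>M) \<le> ennreal (sqrt 2)"
proof -
  have "expectation (\<lambda>\<omega>. (U \<omega>)\<^sup>2) * x\<^sup>2 / 20 \<le> x\<^sup>2 / 4" for x :: real
  proof -
    have "expectation (\<lambda>\<omega>. (U \<omega>)\<^sup>2) * x\<^sup>2 \<le> 2 * x\<^sup>2"
      using assms(3) by (rule mult_right_mono) simp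
    moreover have "0 \<le> x\<^sup>2" by simp
    ultimately show ?thesis by linarith
  qed
  then have "(\<integral>\<^sup>+\<omega>. ennreal (exp ((U \<omega>)\<^sup>2 / 20)) \<partial>M) \<le> (\<integral>\<^sup>+x. ennreal (exp (x\<^sup>2 / 4)) \<partial>gauss)"
    unfolding exp_square_gaussian[OF assms(1,2)]
    by (intro nn_integral_mono ennreal_leI) auto
  then show ?thesis by (simp add: nn_integral_exp_square_gauss)
qed

text \<open>
  The decorrelation estimate: nearly uncorrelated \<open>U\<close>, \<open>V\<close> have nearly uncorrelated squared
  exponentials. Linearising both squared exponentials as in
  \<open>exp_square_gaussian\<close> reduces the joint moment to the moment generating functions of the
  linear combinations \<open>x U + y V\<close>, so that no two-dimensional density occurs.
\<close>

lemma (in prob_space) exp_squares_jointly_gaussian_le: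
  assumes lin: "\<And>x y. gaussian_rv M (\<lambda>\<omega>. x * U \<omega> + y * V \<omega>)"
    and U0: "expectation U = 0" and V0: "expectation V = 0"
    and U2: "expectation (\<lambda>\<omega>. (U \<omega>)\<^sup>2) \<le> 2" and V2: "expectation (\<lambda>\<omega>. (V \<omega>)\<^sup>2) \<le> 2"
    and r: "\<bar>expectation (\<lambda>\<omega>. U \<omega> * V \<omega>)\<bar> \<le> R" "R \<le> 2"
  shows "(\<integral>\<^sup>+\<omega>. ennreal (exp ((U \<omega>)\<^sup>2 / 20)) * ennreal (exp ((V \<omega>)\<^sup>2 / 20)) \<partial>M)
    \<le> (\<integral>\<^sup>+\<omega>. ennreal (exp ((U \<omega>)\<^sup>2 / 20)) \<partial>M) * (\<integral>\<^sup>+\<omega>. ennreal (exp ((V \<omega>)\<^sup>2 / 20)) \<partial>M)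
      + ennreal (2 * R)"
proof -
  interpret G: prob_space gauss by (rule prob_space_gauss)
  interpret pair_sigma_finite M gauss ..
  have linU: "gaussian_rv M (\<lambda>\<omega>. x * U \<omega>)" and linV: "gaussian_rv M (\<lambda>\<omega>. x * V \<omega>)" for x
    using lin[of x 0] lin[of 0 x] by simp_all
  have [measurable]: "U \<in> borel_measurable M" "V \<in> borel_measurable M"
    using linU[of 1] linV[of 1] by (simp_all add: gaussian_rv_def)
  define a b r where "a = expectation (\<lambda>\<omega>. (U \<omega>)\<^sup>2)" and "b = expectation (\<lambda>\<omega>. (V \<omega>)\<^sup>2)"
    and "r = expectation (\<lambda>\<omega>. U \<omega> * V \<omega>)"
  have iU: "integrable M (\<lambda>\<omega>. (U \<omega>)\<^sup>2)" and iV: "integrable M (\<lambda>\<omega>. (V \<omega>)\<^sup>2)"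
    using centered_gaussian(1)[OF linU[of 1]] centered_gaussian(1)[OF linV[of 1]] U0 V0 by simp_all
  have iUV: "integrable M (\<lambda>\<omega>. U \<omega> * V \<omega>)"
    by (intro integrable_mult_if_squares iU iV) measurable
  have i1U: "integrable M U" and i1V: "integrable M V"
    by (auto intro!: square_integrable_imp_integrable iU iV)
  \<comment> \<open>Chosen so that \<open>(k * u)\<^sup>2 / 2 = u\<^sup>2 / 20\<close>.\<close>
  define k :: real where "k = sqrt (1 / 10)"
  have k: "k\<^sup>2 = 1 / 10" by (simp add: k_def)
  have mgf: "(\<integral>\<^sup>+\<omega>. ennreal (exp ((k * U \<omega>) * x)) * ennreal (exp ((k * V \<omega>) * y)) \<partial>M)
      = ennreal (exp ((a * x\<^sup>2 + 2 * r * x * y + b * y\<^sup>2) / 20))" for x y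
  proof -
    have lin2: "((k * x) * U \<omega> + (k * y) * V \<omega>)\<^sup>2
        = 1 / 10 * (x\<^sup>2 * (U \<omega>)\<^sup>2 + 2 * x * y * (U \<omega> * V \<omega>) + y\<^sup>2 * (V \<omega>)\<^sup>2)" for \<omega>
      unfolding k[symmetric] by (simp add: power2_eq_square algebra_simps)
    have "(\<integral>\<^sup>+\<omega>. ennreal (exp ((k * U \<omega>) * x)) * ennreal (exp ((k * V \<omega>) * y)) \<partial>M)
        = (\<integral>\<^sup>+\<omega>. ennreal (exp ((k * x) * U \<omega> + (k * y) * V \<omega>)) \<partial>M)"
      by (simp add: ac_simps exp_add flip: ennreal_mult)
    also have "\<dots> = ennreal (exp (expectation (\<lambda>\<omega>. ((k * x) * U \<omega> + (k * y) * V \<omega>)\<^sup>2) / 2))"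
      using i1U i1V U0 V0 by (intro centered_gaussian lin) simp
    also have "expectation (\<lambda>\<omega>. ((k * x) * U \<omega> + (k * y) * V \<omega>)\<^sup>2)
        = 1 / 10 * (x\<^sup>2 * a + 2 * x * y * r + y\<^sup>2 * b)"
      unfolding lin2 using iU iV iUV by (simp add: a_def b_def r_def)
    finally show ?thesis by (simp add: algebra_simps)
  qed
  have "(\<integral>\<^sup>+\<omega>. ennreal (exp ((U \<omega>)\<^sup>2 / 20)) * ennreal (exp ((V \<omega>)\<^sup>2 / 20)) \<partial>M)
      = (\<integral>\<^sup>+\<omega>. (\<integral>\<^sup>+x. ennreal (exp ((k * U \<omega>) * x)) \<partial>gauss)
            * (\<integral>\<^sup>+y. ennreal (exp ((k * V \<omega>) * y)) \<partial>gauss) \<partial>M)"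
    unfolding nn_integral_exp_gauss by (simp add: power_mult_distrib k)
  also have "\<dots> = (\<integral>\<^sup>+\<omega>. (\<integral>\<^sup>+x. (\<integral>\<^sup>+y. ennreal (exp ((k * U \<omega>) * x))
            * ennreal (exp ((k * V \<omega>) * y)) \<partial>gauss) \<partial>gauss) \<partial>M)"
    by (simp add: nn_integral_cmult nn_integral_multc)
  also have "\<dots> = (\<integral>\<^sup>+x. (\<integral>\<^sup>+\<omega>. (\<integral>\<^sup>+y. ennreal (exp ((k * U \<omega>) * x))
            * ennreal (exp ((k * V \<omega>) * y)) \<partial>gauss) \<partial>M) \<partial>gauss)"
    by (rule Fubini'[symmetric]) measurable
  also have "\<dots> = (\<integral>\<^sup>+x. (\<integral>\<^sup>+y. (\<integral>\<^sup>+\<omega>. ennreal (exp ((k * U \<omega>) * x))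
            * ennreal (exp ((k * V \<omega>) * y)) \<partial>M) \<partial>gauss) \<partial>gauss)"
    by (intro nn_integral_cong Fubini'[symmetric]) measurable
  also have "\<dots> = (\<integral>\<^sup>+x. (\<integral>\<^sup>+y. ennreal (exp ((a * x\<^sup>2 + 2 * r * x * y + b * y\<^sup>2) / 20)) \<partial>gauss) \<partial>gauss)"
    unfolding mgf ..
  also have "\<dots> \<le> (\<integral>\<^sup>+x. (\<integral>\<^sup>+y. ennreal (exp (a * x\<^sup>2 / 20)) * ennreal (exp (b * y\<^sup>2 / 20))
      + ennreal R * (ennreal (exp (x\<^sup>2 / 4)) * ennreal (exp (y\<^sup>2 / 4))) \<partial>gauss) \<partial>gauss)"
  proof (intro nn_integral_mono)
    fix x y :: real
    have "exp ((a * x\<^sup>2 + 2 * r * x * y + b * y\<^sup>2) / 20)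
       \<le> exp ((a * x\<^sup>2 + b * y\<^sup>2) / 20) + \<bar>r\<bar> * (exp (x\<^sup>2 / 4) * exp (y\<^sup>2 / 4))"
      using U2 V2 assms(6,7) by (intro exp_quadratic_form_le) (auto simp: a_def b_def r_def)
    also have "\<dots> \<le> exp ((a * x\<^sup>2 + b * y\<^sup>2) / 20) + R * (exp (x\<^sup>2 / 4) * exp (y\<^sup>2 / 4))"
      using assms(6) by (intro add_left_mono mult_right_mono) (auto simp: r_def)
    also have "exp ((a * x\<^sup>2 + b * y\<^sup>2) / 20) = exp (a * x\<^sup>2 / 20) * exp (b * y\<^sup>2 / 20)"
      by (simp add: mult_exp_exp add_divide_distrib)
    finally have "ennreal (exp ((a * x\<^sup>2 + 2 * r * x * y + b * y\<^sup>2) / 20))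
      \<le> ennreal (exp (a * x\<^sup>2 / 20) * exp (b * y\<^sup>2 / 20) + R * (exp (x\<^sup>2 / 4) * exp (y\<^sup>2 / 4)))"
      by (rule ennreal_leI)
    moreover have "0 \<le> R" using assms(6) by linarith
    ultimately show "ennreal (exp ((a * x\<^sup>2 + 2 * r * x * y + b * y\<^sup>2) / 20))
      \<le> ennreal (exp (a * x\<^sup>2 / 20)) * ennreal (exp (b * y\<^sup>2 / 20))
        + ennreal R * (ennreal (exp (x\<^sup>2 / 4)) * ennreal (exp (y\<^sup>2 / 4)))"
      by (simp add: ennreal_mult ennreal_plus)
  qed
  also have "\<dots> = (\<integral>\<^sup>+x. ennreal (exp (a * x\<^sup>2 / 20)) \<partial>gauss) * (\<integral>\<^sup>+y. ennreal (exp (b * y\<^sup>2 / 20)) \<partial>gauss)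
      + ennreal R * (ennreal (sqrt 2) * ennreal (sqrt 2))"
    by (simp add: nn_integral_add nn_integral_cmult nn_integral_multc nn_integral_exp_square_gauss)
  also have "ennreal R * (ennreal (sqrt 2) * ennreal (sqrt 2)) = ennreal (2 * R)"
  proof -
    have "ennreal (sqrt 2) * ennreal (sqrt 2) = 2" by (simp flip: ennreal_mult)
    then show ?thesis using ennreal_mult''[of 2 R] by (simp add: mult.commute)
  qed
  finally show ?thesis
    unfolding exp_square_gaussian[OF linU U0] exp_square_gaussian[OF linV V0] a_def b_def .
qed

section \<open>Covariances of increments\<close>

text \<open>
  The second difference is \<open>h\<^sup>2\<close> times a second derivative \<open>a (a - 1) y powr (a - 2)\<close>, and
  \<open>y powr (a - 2)\<close> is decreasing. This decay is what decorrelates distant increments.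
\<close>

lemma second_difference_powr_le:
  fixes a h x :: real
  assumes "0 < a" "a < 2" "0 < h" "h < x"
  shows "\<bar>(x + h) powr a - 2 * x powr a + (x - h) powr a\<bar> \<le> 2 * h\<^sup>2 * (x - h) powr (a - 2)"
proof -
  define G where "G y = (y + h) powr a - y powr a" for y
  have "\<exists>z. x - h < z \<and> z < x \<and> G x - G (x - h)
      = (x - (x - h)) * (a * (z + h) powr (a - 1) - a * z powr (a - 1))"
    unfolding G_def using assms by (intro MVT2) (auto intro!: derivative_eq_intros)
  then obtain z where z: "x - h < z" "z < x"
    and Gz: "G x - G (x - h) = h * (a * (z + h) powr (a - 1) - a * z powr (a - 1))"
    by auto
  have "\<exists>y. z < y \<and> y < z + h \<and> a * (z + h) powr (a - 1) - a * z powr (a - 1)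
      = (z + h - z) * (a * ((a - 1) * y powr (a - 1 - 1)))"
    using assms z by (intro MVT2) (auto intro!: derivative_eq_intros)
  then obtain y where y: "z < y"
    and yz: "a * (z + h) powr (a - 1) - a * z powr (a - 1) = h * (a * ((a - 1) * y powr (a - 2)))"
    by (auto simp: algebra_simps)
  have "(x + h) powr a - 2 * x powr a + (x - h) powr a = G x - G (x - h)"
    by (simp add: G_def)
  also have "\<dots> = h\<^sup>2 * ((a * (a - 1)) * y powr (a - 2))"
    unfolding Gz yz by (simp add: power2_eq_square)
  also have "\<bar>\<dots>\<bar> = h\<^sup>2 * (\<bar>a * (a - 1)\<bar> * y powr (a - 2))"
    by (simp add: abs_mult)
  also have "\<dots> \<le> h\<^sup>2 * (2 * (x - h) powr (a - 2))"
  proof -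
    have "\<bar>a * (a - 1)\<bar> \<le> 2"
    proof -
      have "\<bar>a\<bar> * \<bar>a - 1\<bar> \<le> 2 * 1" using assms by (intro mult_mono) auto
      then show ?thesis by (simp add: abs_mult)
    qed
    moreover have "y powr (a - 2) \<le> (x - h) powr (a - 2)"
      using assms z y by (intro powr_mono2') auto
    ultimately show ?thesis by (intro mult_left_mono mult_mono) auto
  qed
  finally show ?thesis by simp
qed

text \<open>
  For \<open>a \<ge> 1\<close> the left-hand side is nonpositive by convexity, for \<open>a < 1\<close> it measures the concavity
  defect. Both cases follow from one monotonicity argument: as functions of \<open>t\<close> the two sides agree
  (both vanish) at \<open>t = s\<close>, and the left one has the smaller derivative.
\<close>

lemma powr_midpoint_defect_le:
  fixes a s t :: real
  assumes "0 < a" "a < 2" "0 \<le> s" "s \<le> t"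
  shows "(s + t) powr a - 2 powr (a - 1) * (s powr a + t powr a) \<le> (t - s) powr a"
proof -
  define f where "f t = (s + t) powr a - 2 powr (a - 1) * (s powr a + t powr a) - (t - s) powr a" for t
  have "f t \<le> f s"
  proof (rule DERIV_nonpos_imp_decreasing_open[OF assms(4)])
    fix y assume y: "s < y" "y < t"
    have "(f has_real_derivative
        a * (s + y) powr (a - 1) - 2 powr (a - 1) * (a * y powr (a - 1)) - a * (y - s) powr (a - 1)) (at y)"
      unfolding f_def using y assms by (auto intro!: derivative_eq_intros)
    moreover have "(s + y) powr (a - 1) \<le> 2 powr (a - 1) * y powr (a - 1) + (y - s) powr (a - 1)"
    proof (cases "1 \<le> a")
      case True
      then have "(s + y) powr (a - 1) \<le> (2 * y) powr (a - 1)"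
        using y assms by (intro powr_mono2) auto
      also have "\<dots> = 2 powr (a - 1) * y powr (a - 1)" using y assms by (simp add: powr_mult)
      also have "\<dots> \<le> 2 powr (a - 1) * y powr (a - 1) + (y - s) powr (a - 1)" by simp
      finally show ?thesis .
    next
      case False
      then have "(s + y) powr (a - 1) \<le> (y - s) powr (a - 1)"
        using y assms by (intro powr_mono2') auto
      moreover have "0 \<le> 2 powr (a - 1) * y powr (a - 1)" by simp
      ultimately show ?thesis by linarith
    qed
    then have "a * (s + y) powr (a - 1) \<le> a * (2 powr (a - 1) * y powr (a - 1) + (y - s) powr (a - 1))"
      using assms(1) by (intro mult_left_mono) auto
    then have "a * (s + y) powr (a - 1) - 2 powr (a - 1) * (a * y powr (a - 1)) - a * (y - s) powr (a - 1) \<le> 0"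
      by (simp add: algebra_simps)
    ultimately show "\<exists>d. (f has_real_derivative d) (at y) \<and> d \<le> 0" by blast
  next
    show "continuous_on {s..t} f"
      unfolding f_def using assms by (intro continuous_on_powr' continuous_intros) auto
  qed
  also have "f s = 0"
  proof -
    have "(s + s) powr a = (2 * s) powr a" by simp
    also have "\<dots> = 2 * 2 powr (a - 1) * s powr a"
      using assms by (simp add: powr_mult powr_diff)
    finally show ?thesis using assms by (simp add: f_def)
  qed
  finally show ?thesis by (simp add: f_def)
qed

definition sfbm_cov :: "real \<Rightarrow> real \<Rightarrow> real \<Rightarrow> real" where
  "sfbm_cov H s t = s powr (2 * H) + t powr (2 * H)
     - 1 / 2 * ((s + t) powr (2 * H) + \<bar>s - t\<bar> powr (2 * H))"

lemma sfbm_cov_commute: "sfbm_cov H s t = sfbm_cov H t s"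
  by (simp add: sfbm_cov_def add.commute abs_minus_commute)

text \<open>
  Up to the midpoint defect, which is at most \<open>h powr (2 * H)\<close>, the increment has the variance
  \<open>h powr (2 * H)\<close> of a fractional Brownian motion.
\<close>

lemma sfbm_increment_variance_le:
  assumes "0 < H" "H < 1" "0 \<le> s" "0 < h"
  shows "sfbm_cov H (s + h) (s + h) - 2 * sfbm_cov H (s + h) s + sfbm_cov H s s \<le> 2 * h powr (2 * H)"
proof -
  have dbl: "(t + t) powr (2 * H) = 2 * 2 powr (2 * H - 1) * t powr (2 * H)" if "0 \<le> t" for t
  proof -
    have "(t + t) powr (2 * H) = (2 * t) powr (2 * H)" by simp
    then show ?thesis using that by (simp add: powr_mult powr_diff)
  qed
  have "(s + (s + h)) powr (2 * H) - 2 powr (2 * H - 1) * (s powr (2 * H) + (s + h) powr (2 * H))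
      \<le> (s + h - s) powr (2 * H)"
    using assms by (intro powr_midpoint_defect_le) auto
  moreover have "(s + (s + h)) powr (2 * H) = (s + h + s) powr (2 * H)" by (simp add: add.commute)
  ultimately show ?thesis
    unfolding sfbm_cov_def using assms dbl[of s] dbl[of "s + h"] by (simp add: algebra_simps)
qed

text \<open>
  Taking increments in both arguments cancels \<open>s powr (2 * H)\<close> and \<open>t powr (2 * H)\<close>. What remains are
  second differences of \<open>x powr (2 * H)\<close> at \<open>\<bar>s - t\<bar>\<close> and at \<open>s + t + h\<close>; both points are at least
  \<open>sqrt h\<close>, so both are small compared with \<open>h powr (2 * H)\<close>.
\<close>

lemma sfbm_increment_covariance_le:
  assumes "0 < H" "H < 1" "0 \<le> s" "0 \<le> t" "0 < h" "h \<le> 1 / 4" "sqrt h \<le> \<bar>s - t\<bar>"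
  shows "\<bar>sfbm_cov H (s + h) (t + h) - sfbm_cov H (s + h) t - sfbm_cov H s (t + h) + sfbm_cov H s t\<bar>
    \<le> h powr (2 * H) * (8 * h powr (1 - H))"
proof -
  define a where "a = 2 * H"
  have a: "0 < a" "a < 2" using assms by (auto simp: a_def)
  define D where "D x = (x + h) powr a - 2 * x powr a + (x - h) powr a" for x
  \<comment> \<open>With \<open>h \<le> 1/4\<close> the interval of a second difference at a point \<open>x \<ge> sqrt h\<close> stays above \<open>sqrt h / 2\<close>.\<close>
  have sq: "h \<le> sqrt h / 2"
  proof -
    have "sqrt h \<le> sqrt (1/4)" using assms(6) by (rule real_sqrt_le_mono)
    then have "sqrt h \<le> 1 / 2" by (simp add: real_sqrt_divide)
    then have "sqrt h * sqrt h \<le> sqrt h * (1 / 2)" using assms(5) by (intro mult_left_mono) auto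
    then show ?thesis using assms(5) by simp
  qed
  have D: "\<bar>D x\<bar> \<le> h powr a * (8 * h powr (1 - H))" if "sqrt h \<le> x" for x
  proof -
    have h0: "0 < sqrt h" using assms(5) by simp
    have "\<bar>D x\<bar> \<le> 2 * h\<^sup>2 * (x - h) powr (a - 2)"
      unfolding D_def using a assms(5) sq that h0 by (intro second_difference_powr_le) linarith+
    also have "\<dots> \<le> 2 * h\<^sup>2 * (sqrt h / 2) powr (a - 2)"
      using a assms(5) sq that h0 by (intro mult_left_mono powr_mono2') auto
    also have "\<dots> = 2 * 2 powr (2 - a) * (h powr 2 * h powr ((a - 2) / 2))"
    proof -
      have "(sqrt h / 2) powr (a - 2) = (sqrt h) powr (a - 2) * 2 powr (2 - a)"
        using assms(5) powr_minus[of 2 "a - 2"] by (simp add: powr_divide field_simps)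
      also have "(sqrt h) powr (a - 2) = h powr ((a - 2) / 2)"
        using assms(5) by (simp add: powr_half_sqrt[symmetric] powr_powr)
      finally show ?thesis using assms(5) by (simp add: ac_simps)
    qed
    also have "h powr 2 * h powr ((a - 2) / 2) = h powr a * h powr (1 - H)"
      unfolding powr_add[symmetric] by (rule arg_cong[where f = "\<lambda>e. h powr e"]) (simp add: a_def field_simps)
    also have "2 * 2 powr (2 - a) * (h powr a * h powr (1 - H)) \<le> 8 * (h powr a * h powr (1 - H))"
    proof -
      have "2 powr (2 - a) \<le> 2 powr (2::real)" using a by (intro powr_mono) auto
      then show ?thesis by (intro mult_right_mono) auto
    qed
    finally show ?thesis by simp
  qed
  have *: "\<bar>sfbm_cov H (s + h) (t + h) - sfbm_cov H (s + h) t - sfbm_cov H s (t + h) + sfbm_cov H s t\<bar>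
    \<le> h powr a * (8 * h powr (1 - H))" if "0 \<le> s" "sqrt h \<le> t - s" for s t
  proof -
    have h0: "0 < sqrt h" using assms(5) by simp
    have ab: "\<bar>s - t\<bar> = t - s" "\<bar>s + h - (t + h)\<bar> = t - s" "\<bar>s - (t + h)\<bar> = t - s + h"
      "\<bar>s + h - t\<bar> = t - s - h"
      using that sq h0 assms(5) by linarith+
    have "s + h + (t + h) = s + t + h + h" "s + h + t = s + t + h" "s + (t + h) = s + t + h"
      "s + t = s + t + h - h"
      by auto
    then have "sfbm_cov H (s + h) (t + h) - sfbm_cov H (s + h) t - sfbm_cov H s (t + h) + sfbm_cov H s t
        = 1 / 2 * D (t - s) - 1 / 2 * D (s + t + h)"
      unfolding sfbm_cov_def ab D_def a_def by (simp add: algebra_simps)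
    also have "\<bar>\<dots>\<bar> \<le> 1 / 2 * \<bar>D (t - s)\<bar> + 1 / 2 * \<bar>D (s + t + h)\<bar>" by linarith
    finally show ?thesis using D[of "t - s"] D[of "s + t + h"] that assms(5) by linarith
  qed
  show ?thesis
  proof (cases "s \<le> t")
    case True
    then show ?thesis using *[of s t] assms by (simp add: a_def)
  next
    case False
    have "sfbm_cov H (s + h) (t + h) - sfbm_cov H (s + h) t - sfbm_cov H s (t + h) + sfbm_cov H s t
      = sfbm_cov H (t + h) (s + h) - sfbm_cov H (t + h) s - sfbm_cov H t (s + h) + sfbm_cov H t s"
      by (simp add: sfbm_cov_commute)
    then show ?thesis using *[of t s] False assms by (simp add: a_def)
  qed
qed

text \<open>
  A Gaussian process is described by sums over sets of times. Increments can share times (for example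
  \<open>s + h = t\<close>), so coefficients of equal times have to be collected first.
\<close>

lemma gaussian_rv_linear_combination:
  assumes "gaussian_process M T X" "finite I" "\<tau> ` I \<subseteq> T"
  shows "gaussian_rv M (\<lambda>\<omega>. \<Sum>i\<in>I. c i * X (\<tau> i) \<omega>)"
proof -
  have "(\<Sum>i\<in>I. c i * X (\<tau> i) \<omega>) = (\<Sum>t\<in>\<tau> ` I. (\<Sum>i\<in>{i\<in>I. \<tau> i = t}. c i) * X t \<omega>)" for \<omega>
  proof -
    have "(\<Sum>i\<in>I. c i * X (\<tau> i) \<omega>) = (\<Sum>t\<in>\<tau> ` I. \<Sum>i\<in>{i\<in>I. \<tau> i = t}. c i * X (\<tau> i) \<omega>)"
      using assms(2) by (rule sum.image_gen)
    also have "\<dots> = (\<Sum>t\<in>\<tau> ` I. (\<Sum>i\<in>{i\<in>I. \<tau> i = t}. c i) * X t \<omega>)"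
      by (intro sum.cong refl) (simp add: sum_distrib_right)
    finally show ?thesis .
  qed
  moreover have "gaussian_rv M (\<lambda>\<omega>. \<Sum>t\<in>\<tau> ` I. (\<Sum>i\<in>{i\<in>I. \<tau> i = t}. c i) * X t \<omega>)"
    using assms unfolding gaussian_process_def by simp
  ultimately show ?thesis by simp
qed

text \<open>
  The factor \<open>h powr (- H)\<close> brings the increments of subfractional Brownian motion to variance at
  most 2 on every scale \<open>h\<close>.
\<close>

definition scaled_increment :: "real \<Rightarrow> (real \<Rightarrow> real) \<Rightarrow> real \<Rightarrow> real \<Rightarrow> real" where
  "scaled_increment H f h s = h powr (- H) * (f (s + h) - f s)"

context prob_space
begin

context
  fixes H :: real and S :: "real \<Rightarrow> 'a \<Rightarrow> real" and h :: real
  assumes H: "0 < H" "H < 1" and S: "subfractional_BM M H S" and h: "0 < h"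
begin

lemma sfbm_gaussian: "gaussian_process M {0..} S"
  using S by (simp add: subfractional_BM_def)

lemma sfbm_measurable: "0 \<le> t \<Longrightarrow> S t \<in> borel_measurable M"
  using gaussian_rv_linear_combination[OF sfbm_gaussian, of "{t}" id "\<lambda>_. 1"]
  by (simp add: gaussian_rv_def)

lemma sfbm_expectation: "0 \<le> t \<Longrightarrow> expectation (S t) = 0"
  using S by (simp add: subfractional_BM_def)

lemma sfbm_covariance:
  "0 \<le> s \<Longrightarrow> 0 \<le> t \<Longrightarrow> expectation (\<lambda>\<omega>. S t \<omega> * S s \<omega>) = sfbm_cov H s t"
  using S by (simp add: subfractional_BM_def sfbm_cov_def)

lemma sfbm_square_integrable: "0 \<le> t \<Longrightarrow> integrable M (\<lambda>\<omega>. (S t \<omega>)\<^sup>2)"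
  using gaussian_rv_linear_combination[OF sfbm_gaussian, of "{t}" id "\<lambda>_. 1"] sfbm_expectation
  by (intro centered_gaussian) simp_all

lemma sfbm_integrable: "0 \<le> t \<Longrightarrow> integrable M (S t)"
  by (rule square_integrable_imp_integrable[OF sfbm_measurable sfbm_square_integrable])

lemma sfbm_product_integrable:
  "0 \<le> s \<Longrightarrow> 0 \<le> t \<Longrightarrow> integrable M (\<lambda>\<omega>. S s \<omega> * S t \<omega>)"
  by (intro integrable_mult_if_squares sfbm_measurable sfbm_square_integrable)

abbreviation incr :: "real \<Rightarrow> 'a \<Rightarrow> real" where
  "incr s \<omega> \<equiv> scaled_increment H (\<lambda>t. S t \<omega>) h s"

lemma incr_jointly_gaussian:
  assumes "0 \<le> s" "0 \<le> t"
  shows "gaussian_rv M (\<lambda>\<omega>. x * incr s \<omega> + y * incr t \<omega>)"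
proof -
  define k where "k = h powr (- H)"
  define \<tau> where "\<tau> i = [s + h, s, t + h, t] ! i" for i
  define c where "c i = [x * k, - (x * k), y * k, - (y * k)] ! i" for i
  have "\<tau> ` {0, 1, 2, 3} \<subseteq> {0..}" using assms h by (simp add: \<tau>_def)
  then have "gaussian_rv M (\<lambda>\<omega>. \<Sum>i\<in>{0, 1, 2, 3}. c i * S (\<tau> i) \<omega>)"
    by (intro gaussian_rv_linear_combination[OF sfbm_gaussian]) auto
  moreover have "(\<Sum>i\<in>{0, 1, 2, 3}. c i * S (\<tau> i) \<omega>) = x * incr s \<omega> + y * incr t \<omega>" for \<omega>
    by (simp add: scaled_increment_def c_def \<tau>_def k_def algebra_simps)
  ultimately show ?thesis by simp
qed

lemma incr_expectation: "0 \<le> s \<Longrightarrow> expectation (incr s) = 0"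
  using h by (simp add: scaled_increment_def sfbm_expectation sfbm_integrable)

lemma incr_covariance:
  assumes "0 \<le> s" "0 \<le> t"
  shows "expectation (\<lambda>\<omega>. incr s \<omega> * incr t \<omega>)
    = h powr (- (2 * H)) * (sfbm_cov H (s + h) (t + h) - sfbm_cov H (s + h) t
       - sfbm_cov H s (t + h) + sfbm_cov H s t)"
proof -
  have hh: "h powr (- (2 * H)) = h powr (- H) * h powr (- H)"
    by (simp flip: powr_add)
  have "incr s \<omega> * incr t \<omega> = h powr (- (2 * H)) * (S (t + h) \<omega> * S (s + h) \<omega> - S t \<omega> * S (s + h) \<omega>
      - S (t + h) \<omega> * S s \<omega> + S t \<omega> * S s \<omega>)" for \<omega>
    unfolding hh by (simp add: scaled_increment_def algebra_simps)
  then show ?thesis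
    using assms h by (simp add: sfbm_product_integrable sfbm_covariance)
qed

lemma incr_variance_le:
  assumes "0 \<le> s"
  shows "expectation (\<lambda>\<omega>. (incr s \<omega>)\<^sup>2) \<le> 2"
proof -
  have "expectation (\<lambda>\<omega>. (incr s \<omega>)\<^sup>2) = h powr (- (2 * H)) *
      (sfbm_cov H (s + h) (s + h) - 2 * sfbm_cov H (s + h) s + sfbm_cov H s s)"
    using incr_covariance[OF assms assms] sfbm_cov_commute[of H s "s + h"]
    by (simp add: power2_eq_square)
  also have "\<dots> \<le> h powr (- (2 * H)) * (2 * h powr (2 * H))"
    using H assms h by (intro mult_left_mono sfbm_increment_variance_le) auto
  also have "\<dots> = 2" using h by (simp add: powr_minus)
  finally show ?thesis .
qed

lemma incr_measurable: "0 \<le> s \<Longrightarrow> incr s \<in> borel_measurable M"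
  using incr_jointly_gaussian[of s s 1 0] by (simp add: gaussian_rv_def)

lemma incr_square_integrable: "0 \<le> s \<Longrightarrow> integrable M (\<lambda>\<omega>. (incr s \<omega>)\<^sup>2)"
  using incr_jointly_gaussian[of s s 1 0] incr_expectation
  by (intro centered_gaussian) simp_all

lemma incr_covariance_le_2:
  assumes "0 \<le> s" "0 \<le> t"
  shows "\<bar>expectation (\<lambda>\<omega>. incr s \<omega> * incr t \<omega>)\<bar> \<le> 2"
proof -
  have "\<bar>expectation (\<lambda>\<omega>. incr s \<omega> * incr t \<omega>)\<bar> \<le> expectation (\<lambda>\<omega>. \<bar>incr s \<omega> * incr t \<omega>\<bar>)"
    by (rule integral_abs_bound)
  also have "\<dots> \<le> expectation (\<lambda>\<omega>. ((incr s \<omega>)\<^sup>2 + (incr t \<omega>)\<^sup>2) / 2)"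
  proof (rule integral_mono)
    show "integrable M (\<lambda>\<omega>. \<bar>incr s \<omega> * incr t \<omega>\<bar>)"
      using assms
      by (intro integrable_abs integrable_mult_if_squares incr_measurable incr_square_integrable)
    show "integrable M (\<lambda>\<omega>. ((incr s \<omega>)\<^sup>2 + (incr t \<omega>)\<^sup>2) / 2)"
      using assms incr_square_integrable by simp
    show "\<bar>incr s \<omega> * incr t \<omega>\<bar> \<le> ((incr s \<omega>)\<^sup>2 + (incr t \<omega>)\<^sup>2) / 2" for \<omega>
      using sum_squares_bound[of "\<bar>incr s \<omega>\<bar>" "\<bar>incr t \<omega>\<bar>"] by (simp add: abs_mult)
  qed
  also have "\<dots> \<le> 2"
    using assms incr_square_integrable incr_variance_le[of s] incr_variance_le[of t] by simp
  finally show ?thesis .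
qed

text \<open>
  For \<open>h > 1/4\<close> the right-hand side is at least 2, the trivial bound; hence one estimate serves
  all dyadic scales.
\<close>

lemma incr_covariance_decay:
  assumes "0 \<le> s" "0 \<le> t" "sqrt h \<le> \<bar>s - t\<bar>"
  shows "\<bar>expectation (\<lambda>\<omega>. incr s \<omega> * incr t \<omega>)\<bar> \<le> 8 * h powr (1 - H)"
proof (cases "h \<le> 1 / 4")
  case True
  have "\<bar>expectation (\<lambda>\<omega>. incr s \<omega> * incr t \<omega>)\<bar>
      \<le> h powr (- (2 * H)) * (h powr (2 * H) * (8 * h powr (1 - H)))"
    using sfbm_increment_covariance_le[OF H assms(1,2) h True assms(3)]
    unfolding incr_covariance[OF assms(1,2)] by (simp add: abs_mult mult_left_mono)
  also have "\<dots> = 8 * h powr (1 - H)" using h by (simp add: powr_minus field_simps)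
  finally show ?thesis .
next
  case False
  have "(1 / 4 :: real) = (1 / 4) powr 1" by simp
  also have "\<dots> \<le> (1 / 4) powr (1 - H)" using H by (intro powr_mono') auto
  also have "\<dots> \<le> h powr (1 - H)" using False H by (intro powr_mono2) auto
  finally show ?thesis using incr_covariance_le_2[OF assms(1,2)] by linarith
qed

end

end

section \<open>A continuous, jointly measurable modification\<close>

lemma gaussian_rv_cong_AE:
  assumes "gaussian_rv M X" "Y \<in> borel_measurable M" "AE \<omega> in M. X \<omega> = Y \<omega>"
  shows "gaussian_rv M Y"
proof -
  have "distr M borel X = distr M borel Y"
    using assms by (intro distr_cong_AE) (auto simp: gaussian_rv_def)
  then show ?thesis using assms by (simp add: gaussian_rv_def)
qed

text \<open>
  Discarding a null set of paths and freezing them at negative times gives a process all of whose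
  paths are continuous on the whole line, so that joint measurability and Fubini are available.
\<close>

lemma (in prob_space) continuous_modification:
  assumes S: "subfractional_BM M H S"
  obtains X where "subfractional_BM M H X" "\<And>t. X t \<in> borel_measurable M"
    "\<And>\<omega>. continuous_on UNIV (\<lambda>t. X t \<omega>)" "AE \<omega> in M. \<forall>t\<ge>0. X t \<omega> = S t \<omega>"
proof -
  have "AE \<omega> in M. continuous_on {0..} (\<lambda>t. S t \<omega>)"
    using S by (simp add: subfractional_BM_def)
  then obtain N where N: "{\<omega> \<in> space M. \<not> continuous_on {0..} (\<lambda>t. S t \<omega>)} \<subseteq> N"
    "emeasure M N = 0" "N \<in> sets M"
    by (rule AE_E)
  define X where "X t \<omega> = indicator (space M - N) \<omega> * S (max 0 t) \<omega>" for t \<omega>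
  have gS: "gaussian_process M {0..} S" using S by (simp add: subfractional_BM_def)
  have mS: "S t \<in> borel_measurable M" if "0 \<le> t" for t
    using gaussian_rv_linear_combination[OF gS, of "{t}" id "\<lambda>_. 1"] that
    by (simp add: gaussian_rv_def)
  have mX: "X t \<in> borel_measurable M" for t
    unfolding X_def using mS[of "max 0 t"] N by measurable
  have "AE \<omega> in M. \<omega> \<notin> N" using N by (intro AE_not_in) auto
  then have XS: "AE \<omega> in M. \<forall>t\<ge>0. X t \<omega> = S t \<omega>"
    using AE_space by eventually_elim (auto simp: X_def)
  have cX: "continuous_on UNIV (\<lambda>t. X t \<omega>)" for \<omega>
  proof (cases "\<omega> \<in> space M - N")
    case True
    then have "continuous_on {0..} (\<lambda>t. S t \<omega>)" using N by auto
    then have "continuous_on UNIV (\<lambda>t. S (max 0 t) \<omega>)"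
      by (rule continuous_on_compose2) (auto intro!: continuous_intros)
    then show ?thesis using True by (simp add: X_def)
  qed (simp add: X_def)
  have "subfractional_BM M H X"
  proof -
    have "gaussian_process M {0..} X"
      unfolding gaussian_process_def
    proof (intro allI impI)
      fix F :: "real set" and c :: "real \<Rightarrow> real" assume F: "finite F \<and> F \<subseteq> {0..}"
      show "gaussian_rv M (\<lambda>\<omega>. \<Sum>t\<in>F. c t * X t \<omega>)"
      proof (rule gaussian_rv_cong_AE)
        show "gaussian_rv M (\<lambda>\<omega>. \<Sum>t\<in>F. c t * S t \<omega>)"
          using gS F by (simp add: gaussian_process_def)
        show "(\<lambda>\<omega>. \<Sum>t\<in>F. c t * X t \<omega>) \<in> borel_measurable M" using mX by measurable
        show "AE \<omega> in M. (\<Sum>t\<in>F. c t * S t \<omega>) = (\<Sum>t\<in>F. c t * X t \<omega>)"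
          using XS by eventually_elim (use F in \<open>auto intro!: sum.cong\<close>)
      qed
    qed
    moreover have "expectation (X t) = expectation (S t)" if "0 \<le> t" for t
      using mX mS that XS by (intro integral_cong_AE) auto
    moreover have "expectation (\<lambda>\<omega>. X t \<omega> * X s \<omega>) = expectation (\<lambda>\<omega>. S t \<omega> * S s \<omega>)"
      if "0 \<le> t" "0 \<le> s" for s t
      using mX mS that XS by (intro integral_cong_AE borel_measurable_times) auto
    moreover have "continuous_on {0..} (\<lambda>t. X t \<omega>)" for \<omega>
      using cX by (rule continuous_on_subset) simp
    ultimately show ?thesis using S by (simp add: subfractional_BM_def)
  qed
  then show ?thesis using mX XS cX that by blast
qed

text \<open>
  The process is the limit of its step approximations at times \<open>\<lfloor>n t\<rfloor> / n\<close>, which take only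
  countably many times into account.
\<close>

lemma measurable_continuous_process:
  fixes X :: "real \<Rightarrow> 'a \<Rightarrow> real"
  assumes meas: "\<And>t. X t \<in> borel_measurable M"
    and cont: "\<And>\<omega>. continuous_on UNIV (\<lambda>t. X t \<omega>)"
  shows "(\<lambda>(\<omega>, t). X t \<omega>) \<in> borel_measurable (M \<Otimes>\<^sub>M borel)"
proof (rule borel_measurable_LIMSEQ_real)
  define g where "g n t = of_int \<lfloor>real (Suc n) * t\<rfloor> / real (Suc n)" for n and t :: real
  have g: "(\<lambda>n. g n t) \<longlonglongrightarrow> t" for t
  proof (rule tendsto_sandwich)
    show "(\<lambda>n. t - 1 / real (Suc n)) \<longlonglongrightarrow> t"
      using tendsto_diff[OF tendsto_const lim_1_over_n[THEN LIMSEQ_Suc], of t] by simp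
    show "\<forall>\<^sub>F n in sequentially. t - 1 / real (Suc n) \<le> g n t"
    proof (intro always_eventually allI)
      fix n
      have "real (Suc n) * t - 1 \<le> of_int \<lfloor>real (Suc n) * t\<rfloor>" by linarith
      then have "(real (Suc n) * t - 1) / real (Suc n) \<le> g n t"
        unfolding g_def by (rule divide_right_mono) simp
      then show "t - 1 / real (Suc n) \<le> g n t" by (simp add: diff_divide_distrib)
    qed
    show "\<forall>\<^sub>F n in sequentially. g n t \<le> t"
    proof (intro always_eventually allI)
      fix n
      have "of_int \<lfloor>real (Suc n) * t\<rfloor> \<le> real (Suc n) * t" by linarith
      then have "g n t \<le> real (Suc n) * t / real (Suc n)"
        unfolding g_def by (rule divide_right_mono) simp
      then show "g n t \<le> t" by simp
    qed
  qed simp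
  show "(\<lambda>(\<omega>, t). X (g n t) \<omega>) \<in> borel_measurable (M \<Otimes>\<^sub>M borel)" for n
  proof -
    have "(\<lambda>p. X (of_int \<lfloor>real (Suc n) * snd p\<rfloor> / real (Suc n)) (fst p)) \<in> borel_measurable (M \<Otimes>\<^sub>M borel)"
    proof (rule measurable_compose_countable[where
          f = "\<lambda>i p. X (of_int i / real (Suc n)) (fst p)" and g = "\<lambda>p. \<lfloor>real (Suc n) * snd p\<rfloor>"])
      show "(\<lambda>p. X (of_int i / real (Suc n)) (fst p)) \<in> borel_measurable (M \<Otimes>\<^sub>M borel)" for i :: int
        using meas[of "of_int i / real (Suc n)"] by measurable
      show "(\<lambda>p. \<lfloor>real (Suc n) * snd p\<rfloor>) \<in> measurable (M \<Otimes>\<^sub>M borel) (count_space UNIV)"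
        by measurable
    qed
    then show ?thesis by (simp add: g_def case_prod_beta')
  qed
  show "(\<lambda>n. case p of (\<omega>, t) \<Rightarrow> X (g n t) \<omega>) \<longlonglongrightarrow> (case p of (\<omega>, t) \<Rightarrow> X t \<omega>)" for p
    using isCont_tendsto_compose[OF _ g, of "snd p" "\<lambda>t. X t (fst p)"] cont[of "fst p"]
    by (simp add: case_prod_beta' continuous_on_eq_continuous_at)
qed

section \<open>Almost sure bounds on the exponential integrals of dyadic increments\<close>

text \<open>
  As \<open>Z\<close> has a finite mean it is almost surely finite, which makes the variance identity for real
  random variables applicable to \<open>enn2real\<close> of it.
\<close>

lemma (in prob_space) second_central_moment_le:
  fixes Z :: "'a \<Rightarrow> ennreal" and \<epsilon> :: real
  assumes [measurable]: "Z \<in> borel_measurable M" and m: "(\<integral>\<^sup>+\<omega>. Z \<omega> \<partial>M) = ennreal m" "0 \<le> m"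
    and Z2: "(\<integral>\<^sup>+\<omega>. Z \<omega> * Z \<omega> \<partial>M) \<le> ennreal m * ennreal m + ennreal \<epsilon>" and \<epsilon>: "0 \<le> \<epsilon>"
  shows "(\<integral>\<^sup>+\<omega>. ennreal ((enn2real (Z \<omega>) - m)\<^sup>2) \<partial>M) \<le> ennreal \<epsilon>"
proof -
  define z where "z \<omega> = enn2real (Z \<omega>)" for \<omega>
  have [measurable]: "z \<in> borel_measurable M" unfolding z_def by measurable
  have "AE \<omega> in M. Z \<omega> \<noteq> \<infinity>"
    using m(1) by (intro nn_integral_noteq_infinite) auto
  then have Zz: "AE \<omega> in M. Z \<omega> = ennreal (z \<omega>)"
    by eventually_elim (simp add: z_def less_top)
  have z0: "0 \<le> z \<omega>" for \<omega> by (simp add: z_def)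
  have 1: "(\<integral>\<^sup>+\<omega>. ennreal (z \<omega>) \<partial>M) = ennreal m"
    unfolding m(1)[symmetric] by (rule nn_integral_cong_AE) (use Zz in auto)
  have 2: "(\<integral>\<^sup>+\<omega>. ennreal ((z \<omega>)\<^sup>2) \<partial>M) \<le> ennreal (m\<^sup>2 + \<epsilon>)"
  proof -
    have "(\<integral>\<^sup>+\<omega>. ennreal ((z \<omega>)\<^sup>2) \<partial>M) = (\<integral>\<^sup>+\<omega>. Z \<omega> * Z \<omega> \<partial>M)"
      by (rule nn_integral_cong_AE)
        (use Zz in eventually_elim, simp add: z0 power2_eq_square ennreal_mult)
    also note Z2
    also have "ennreal m * ennreal m + ennreal \<epsilon> = ennreal (m\<^sup>2 + \<epsilon>)"
      using m(2) \<epsilon> by (simp add: power2_eq_square ennreal_mult)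
    finally show ?thesis .
  qed
  have i1: "integrable M z"
    using 1 z0 by (intro integrableI_nonneg) auto
  have i2: "integrable M (\<lambda>\<omega>. (z \<omega>)\<^sup>2)"
    using 2 by (intro integrableI_nonneg) (auto intro: le_less_trans)
  have e1: "expectation z = m"
    using 1 z0 m(2) by (subst integral_eq_nn_integral) auto
  have e2: "expectation (\<lambda>\<omega>. (z \<omega>)\<^sup>2) \<le> m\<^sup>2 + \<epsilon>"
  proof -
    have "ennreal (expectation (\<lambda>\<omega>. (z \<omega>)\<^sup>2)) \<le> ennreal (m\<^sup>2 + \<epsilon>)"
      using 2 by (subst nn_integral_eq_integral[OF i2, symmetric]) auto
    then show ?thesis using \<epsilon> by (subst (asm) ennreal_le_iff) auto
  qed
  have "(\<integral>\<^sup>+\<omega>. ennreal ((z \<omega> - m)\<^sup>2) \<partial>M) = ennreal (expectation (\<lambda>\<omega>. (z \<omega> - m)\<^sup>2))"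
  proof (rule nn_integral_eq_integral)
    show "integrable M (\<lambda>\<omega>. (z \<omega> - m)\<^sup>2)" using i1 i2 by (simp add: power2_diff)
  qed simp
  also have "expectation (\<lambda>\<omega>. (z \<omega> - m)\<^sup>2) \<le> \<epsilon>"
    using variance_eq[OF i1 i2] e1 e2 by simp
  finally show ?thesis by (simp add: z_def ennreal_leI)
qed

text \<open>
  The centered squares have a finite expected sum, so almost surely their sum is finite and each
  term is bounded by it.
\<close>

lemma (in prob_space) AE_bounded_if_summable_variances:
  fixes Z :: "nat \<Rightarrow> 'a \<Rightarrow> ennreal" and m \<epsilon> :: "nat \<Rightarrow> real"
  assumes [measurable]: "\<And>n. Z n \<in> borel_measurable M"
    and m: "\<And>n. (\<integral>\<^sup>+\<omega>. Z n \<omega> \<partial>M) = ennreal (m n)" "\<And>n. 0 \<le> m n" "\<And>n. m n \<le> C"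
    and Z2: "\<And>n. (\<integral>\<^sup>+\<omega>. Z n \<omega> * Z n \<omega> \<partial>M) \<le> ennreal (m n) * ennreal (m n) + ennreal (\<epsilon> n)"
    and \<epsilon>: "\<And>n. 0 \<le> \<epsilon> n" "summable \<epsilon>"
  shows "AE \<omega> in M. \<exists>K. \<forall>n. Z n \<omega> \<le> ennreal K"
proof -
  define D where "D n \<omega> = (enn2real (Z n \<omega>) - m n)\<^sup>2" for n \<omega>
  have [measurable]: "D n \<in> borel_measurable M" for n unfolding D_def by measurable
  have "(\<integral>\<^sup>+\<omega>. (\<Sum>n. ennreal (D n \<omega>)) \<partial>M) = (\<Sum>n. \<integral>\<^sup>+\<omega>. ennreal (D n \<omega>) \<partial>M)"
    by (intro nn_integral_suminf) measurable
  also have "\<dots> \<le> (\<Sum>n. ennreal (\<epsilon> n))"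
    unfolding D_def using m Z2 \<epsilon> by (intro suminf_le second_central_moment_le) auto
  also have "\<dots> < \<infinity>"
    using \<epsilon> by (simp add: suminf_ennreal_eq[OF \<epsilon>(1) summable_sums[OF \<epsilon>(2)]])
  finally have "AE \<omega> in M. (\<Sum>n. ennreal (D n \<omega>)) \<noteq> \<infinity>"
    by (intro nn_integral_noteq_infinite) auto
  moreover have "AE \<omega> in M. \<forall>n. Z n \<omega> \<noteq> \<infinity>"
    unfolding AE_all_countable
    using m(1) by (intro allI nn_integral_noteq_infinite) auto
  ultimately show ?thesis
  proof eventually_elim
    fix \<omega> assume D: "(\<Sum>n. ennreal (D n \<omega>)) \<noteq> \<infinity>" and Z: "\<forall>n. Z n \<omega> \<noteq> \<infinity>"
    define B where "B = enn2real (\<Sum>n. ennreal (D n \<omega>))"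
    have DB: "D n \<omega> \<le> B" for n
    proof -
      have "ennreal (D n \<omega>) = (\<Sum>k\<in>{n}. ennreal (D k \<omega>))" by simp
      also have "\<dots> \<le> (\<Sum>k. ennreal (D k \<omega>))" by (intro sum_le_suminf) auto
      also have "\<dots> = ennreal B" using D by (simp add: B_def less_top)
      finally show ?thesis by (simp add: B_def)
    qed
    have "Z n \<omega> \<le> ennreal (C + sqrt B)" for n
    proof -
      have "\<bar>enn2real (Z n \<omega>) - m n\<bar> \<le> sqrt B"
        using DB[of n] unfolding D_def by (intro real_le_rsqrt) simp
      then have "enn2real (Z n \<omega>) \<le> C + sqrt B" using m(3)[of n] by linarith
      then have "ennreal (enn2real (Z n \<omega>)) \<le> ennreal (C + sqrt B)" by (rule ennreal_leI)
      then show ?thesis using Z by (simp add: less_top)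
    qed
    then show "\<exists>K. \<forall>n. Z n \<omega> \<le> ennreal K" by blast
  qed
qed

lemma prob_space_unit: "prob_space (restrict_space lborel {0..1::real})"
  by (rule prob_space_restrict_space) auto

text \<open>
  The second moment of \<open>Z\<close> is a double integral over pairs of times \<open>(s, t)\<close>, to which the
  decorrelation estimate applies. Pairs closer than \<open>sqrt h\<close> have covariance at most 2 but fill only
  a strip of area at most \<open>2 * sqrt h\<close>; for all other pairs the covariance is at most
  \<open>8 * h powr (1 - H)\<close>. Both contributions to the variance are powers of \<open>h\<close> with positive exponent.
\<close>

lemma (in prob_space) exp_energy_moments:
  fixes X :: "real \<Rightarrow> 'a \<Rightarrow> real"
  assumes H: "0 < H" "H < 1" and X: "subfractional_BM M H X"
    and meas: "\<And>t. X t \<in> borel_measurable M" and cont: "\<And>\<omega>. continuous_on UNIV (\<lambda>t. X t \<omega>)"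
    and h: "0 < h"
  defines "Z \<equiv> \<lambda>\<omega>. \<integral>\<^sup>+s. ennreal (exp ((scaled_increment H (\<lambda>t. X t \<omega>) h s)\<^sup>2 / 20))
      \<partial>restrict_space lborel {0..1}"
  shows "Z \<in> borel_measurable M"
    and "(\<integral>\<^sup>+\<omega>. Z \<omega> \<partial>M) \<le> ennreal (sqrt 2)"
    and "(\<integral>\<^sup>+\<omega>. Z \<omega> * Z \<omega> \<partial>M) \<le> (\<integral>\<^sup>+\<omega>. Z \<omega> \<partial>M) * (\<integral>\<^sup>+\<omega>. Z \<omega> \<partial>M)
      + ennreal (8 * sqrt h + 16 * h powr (1 - H))"
proof -
  let ?P = "restrict_space lborel {0..1::real}"
  interpret P: prob_space ?P by (rule prob_space_unit)
  interpret pair_sigma_finite M ?P ..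
  have P1: "emeasure ?P {0..1} = 1" by (subst emeasure_restrict_space) auto
  have idP[measurable]: "(\<lambda>x. x) \<in> borel_measurable ?P"
    by (intro measurable_restrict_space1) simp
  have mX: "(\<lambda>p. X (f p) (g p)) \<in> borel_measurable N"
    if "f \<in> borel_measurable N" "g \<in> measurable N M" for f g and N :: "('a \<times> real) measure"
    using measurable_compose[OF measurable_Pair[OF that(2,1)] measurable_continuous_process[OF meas cont]]
    by simp
  define \<phi> where "\<phi> \<omega> s = ennreal (exp ((scaled_increment H (\<lambda>t. X t \<omega>) h s)\<^sup>2 / 20))" for \<omega> s
  have m\<phi>: "(\<lambda>(\<omega>, s). \<phi> \<omega> s) \<in> borel_measurable (M \<Otimes>\<^sub>M ?P)"
  proof -
    have [measurable]: "snd \<in> borel_measurable (M \<Otimes>\<^sub>M ?P)"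
      using measurable_compose[OF measurable_snd idP] by simp
    have "(\<lambda>p. X (snd p + h) (fst p)) \<in> borel_measurable (M \<Otimes>\<^sub>M ?P)"
      "(\<lambda>p. X (snd p) (fst p)) \<in> borel_measurable (M \<Otimes>\<^sub>M ?P)"
      by (intro mX; measurable)+
    then show ?thesis
      unfolding \<phi>_def scaled_increment_def case_prod_beta' by measurable
  qed
  have m\<phi>': "(\<lambda>p. \<phi> (f p) (g p)) \<in> borel_measurable N"
    if "f \<in> measurable N M" "g \<in> measurable N ?P" for f g and N :: "('a \<times> real) measure"
    using measurable_compose[OF measurable_Pair[OF that] m\<phi>] by simp
  have m\<phi>1[measurable]: "\<phi> \<omega> \<in> borel_measurable ?P" if "\<omega> \<in> space M" for \<omega>
    using measurable_compose[OF measurable_Pair1'[OF that] m\<phi>] by simp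
  have m\<phi>2[measurable]: "(\<lambda>\<omega>. \<phi> \<omega> s) \<in> borel_measurable M" if "s \<in> space ?P" for s
    using measurable_compose[OF measurable_Pair2'[OF that] m\<phi>] by simp
  have Z: "Z \<omega> = (\<integral>\<^sup>+s. \<phi> \<omega> s \<partial>?P)" for \<omega>
    by (simp add: Z_def \<phi>_def)
  show mZ[measurable]: "Z \<in> borel_measurable M"
    unfolding Z[abs_def] using m\<phi> by measurable
  define e where "e s = (\<integral>\<^sup>+\<omega>. \<phi> \<omega> s \<partial>M)" for s
  have me[measurable]: "e \<in> borel_measurable ?P"
    unfolding e_def using m\<phi> by measurable
  have EZ: "(\<integral>\<^sup>+\<omega>. Z \<omega> \<partial>M) = (\<integral>\<^sup>+s. e s \<partial>?P)"
    unfolding Z e_def by (rule Fubini'[symmetric, OF m\<phi>])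
  have e_le: "e s \<le> ennreal (sqrt 2)" if "0 \<le> s" for s
    unfolding e_def \<phi>_def
    using incr_jointly_gaussian[OF H X h that that, of _ 0]
      incr_expectation[OF H X h that] incr_variance_le[OF H X h that]
    by (intro exp_square_gaussian_le) simp_all
  show "(\<integral>\<^sup>+\<omega>. Z \<omega> \<partial>M) \<le> ennreal (sqrt 2)"
  proof -
    have "(\<integral>\<^sup>+s. e s \<partial>?P) \<le> (\<integral>\<^sup>+s. ennreal (sqrt 2) \<partial>?P)"
      by (intro nn_integral_mono e_le) simp
    then show ?thesis by (simp add: EZ P1)
  qed
  define R where "R = 8 * h powr (1 - H)"
  have near: "(\<integral>\<^sup>+t. indicator {s - sqrt h<..<s + sqrt h} t \<partial>?P) \<le> ennreal (2 * sqrt h)" for s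
  proof -
    have "(\<integral>\<^sup>+t. indicator {s - sqrt h<..<s + sqrt h} t \<partial>?P)
        = (\<integral>\<^sup>+t. indicator {s - sqrt h<..<s + sqrt h} t * indicator {0..1} t \<partial>lborel)"
      by (subst nn_integral_restrict_space) simp_all
    also have "\<dots> \<le> (\<integral>\<^sup>+t. indicator {s - sqrt h<..<s + sqrt h} t \<partial>lborel)"
      by (intro nn_integral_mono) (simp split: split_indicator)
    also have "\<dots> = ennreal (2 * sqrt h)" using h by (simp add: emeasure_lborel_Ioo)
    finally show ?thesis .
  qed
  have pair: "(\<integral>\<^sup>+\<omega>. \<phi> \<omega> s * \<phi> \<omega> t \<partial>M)
      \<le> e s * e t + (4 * indicator {s - sqrt h<..<s + sqrt h} t + ennreal (2 * R))"
    if s: "s \<in> space ?P" and t: "t \<in> space ?P" for s t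
  proof -
    have st: "0 \<le> s" "0 \<le> t" using s t by (auto simp: space_restrict_space)
    note * = exp_squares_jointly_gaussian_le[OF incr_jointly_gaussian[OF H X h st]
        incr_expectation[OF H X h st(1)] incr_expectation[OF H X h st(2)]
        incr_variance_le[OF H X h st(1)] incr_variance_le[OF H X h st(2)]]
    note two = incr_covariance_le_2[OF H X h st]
    show ?thesis
    proof (cases "\<bar>s - t\<bar> < sqrt h")
      case True
      then have tin: "t \<in> {s - sqrt h<..<s + sqrt h}" by auto
      have "(\<integral>\<^sup>+\<omega>. \<phi> \<omega> s * \<phi> \<omega> t \<partial>M) \<le> e s * e t + ennreal (2 * 2)"
        unfolding e_def \<phi>_def by (rule *[OF two]) simp
      also have "\<dots> \<le> e s * e t + (4 * indicator {s - sqrt h<..<s + sqrt h} t + ennreal (2 * R))"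
        using tin by (intro add_left_mono) simp
      finally show ?thesis .
    next
      case False
      have "(\<integral>\<^sup>+\<omega>. \<phi> \<omega> s * \<phi> \<omega> t \<partial>M) \<le> e s * e t + ennreal (2 * min 2 R)"
        unfolding e_def \<phi>_def using two incr_covariance_decay[OF H X h st] False
        by (intro *) (auto simp: R_def)
      also have "\<dots> \<le> e s * e t + (4 * indicator {s - sqrt h<..<s + sqrt h} t + ennreal (2 * R))"
        by (intro add_left_mono add_increasing ennreal_leI) auto
      finally show ?thesis .
    qed
  qed
  have "(\<integral>\<^sup>+\<omega>. Z \<omega> * Z \<omega> \<partial>M) = (\<integral>\<^sup>+\<omega>. (\<integral>\<^sup>+s. (\<integral>\<^sup>+t. \<phi> \<omega> s * \<phi> \<omega> t \<partial>?P) \<partial>?P) \<partial>M)"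
    by (intro nn_integral_cong) (simp add: Z nn_integral_cmult nn_integral_multc)
  also have "\<dots> = (\<integral>\<^sup>+s. (\<integral>\<^sup>+\<omega>. (\<integral>\<^sup>+t. \<phi> \<omega> s * \<phi> \<omega> t \<partial>?P) \<partial>M) \<partial>?P)"
  proof (rule Fubini'[symmetric])
    have "(\<lambda>p. \<phi> (fst p) (snd p) * Z (fst p)) \<in> borel_measurable (M \<Otimes>\<^sub>M ?P)"
      by (intro borel_measurable_times_ennreal m\<phi>') measurable
    then show "(\<lambda>(\<omega>, s). \<integral>\<^sup>+t. \<phi> \<omega> s * \<phi> \<omega> t \<partial>?P) \<in> borel_measurable (M \<Otimes>\<^sub>M ?P)"
      by (rule measurable_cong[THEN iffD1, rotated])
        (auto simp: Z space_pair_measure nn_integral_cmult)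
  qed
  also have "\<dots> = (\<integral>\<^sup>+s. (\<integral>\<^sup>+t. (\<integral>\<^sup>+\<omega>. \<phi> \<omega> s * \<phi> \<omega> t \<partial>M) \<partial>?P) \<partial>?P)"
  proof (intro nn_integral_cong Fubini'[symmetric])
    fix s assume s: "s \<in> space ?P"
    then have "(\<lambda>p. \<phi> (fst p) s * \<phi> (fst p) (snd p)) \<in> borel_measurable (M \<Otimes>\<^sub>M ?P)"
      by (intro borel_measurable_times_ennreal m\<phi>') measurable
    then show "(\<lambda>(\<omega>, t). \<phi> \<omega> s * \<phi> \<omega> t) \<in> borel_measurable (M \<Otimes>\<^sub>M ?P)"
      by (simp add: case_prod_beta')
  qed
  also have "\<dots> \<le> (\<integral>\<^sup>+s. (\<integral>\<^sup>+t. e s * e t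
      + (4 * indicator {s - sqrt h<..<s + sqrt h} t + ennreal (2 * R)) \<partial>?P) \<partial>?P)"
    by (intro nn_integral_mono pair)
  also have "\<dots> \<le> (\<integral>\<^sup>+s. e s * (\<integral>\<^sup>+t. e t \<partial>?P) + (4 * ennreal (2 * sqrt h) + ennreal (2 * R)) \<partial>?P)"
  proof (intro nn_integral_mono)
    fix s
    have [measurable]: "{s - sqrt h<..<s + sqrt h} \<in> sets borel" by simp
    have [measurable]: "(\<lambda>t. indicator {s - sqrt h<..<s + sqrt h} t :: ennreal) \<in> borel_measurable ?P"
      by (intro measurable_restrict_space1) simp
    have "(\<integral>\<^sup>+t. e s * e t + (4 * indicator {s - sqrt h<..<s + sqrt h} t + ennreal (2 * R)) \<partial>?P)
        = e s * (\<integral>\<^sup>+t. e t \<partial>?P)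
          + (4 * (\<integral>\<^sup>+t. indicator {s - sqrt h<..<s + sqrt h} t \<partial>?P) + ennreal (2 * R))"
      by (simp add: nn_integral_add nn_integral_cmult P1 del: nn_integral_indicator)
    also have "\<dots> \<le> e s * (\<integral>\<^sup>+t. e t \<partial>?P) + (4 * ennreal (2 * sqrt h) + ennreal (2 * R))"
      by (intro add_left_mono add_right_mono mult_left_mono near) simp
    finally show "(\<integral>\<^sup>+t. e s * e t + (4 * indicator {s - sqrt h<..<s + sqrt h} t + ennreal (2 * R)) \<partial>?P)
      \<le> e s * (\<integral>\<^sup>+t. e t \<partial>?P) + (4 * ennreal (2 * sqrt h) + ennreal (2 * R))" .
  qed
  also have "\<dots> = (\<integral>\<^sup>+s. e s \<partial>?P) * (\<integral>\<^sup>+t. e t \<partial>?P) + (4 * ennreal (2 * sqrt h) + ennreal (2 * R))"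
    by (simp add: nn_integral_add nn_integral_multc P1)
  also have "4 * ennreal (2 * sqrt h) + ennreal (2 * R) = ennreal (8 * sqrt h + 16 * h powr (1 - H))"
  proof -
    have "4 * ennreal (2 * sqrt h) = ennreal (8 * sqrt h)"
      using ennreal_mult'[of 4 "2 * sqrt h"] by simp
    then show ?thesis using h by (simp add: R_def)
  qed
  finally show "(\<integral>\<^sup>+\<omega>. Z \<omega> * Z \<omega> \<partial>M) \<le> (\<integral>\<^sup>+\<omega>. Z \<omega> \<partial>M) * (\<integral>\<^sup>+\<omega>. Z \<omega> \<partial>M)
      + ennreal (8 * sqrt h + 16 * h powr (1 - H))"
    unfolding EZ .
qed

text \<open>
  Along \<open>h = (1/2) ^ n\<close> the variance bounds form two geometric series.
\<close>

lemma (in prob_space) AE_bounded_exp_energy: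
  fixes X :: "real \<Rightarrow> 'a \<Rightarrow> real"
  assumes H: "0 < H" "H < 1" and X: "subfractional_BM M H X"
    and meas: "\<And>t. X t \<in> borel_measurable M" and cont: "\<And>\<omega>. continuous_on UNIV (\<lambda>t. X t \<omega>)"
  shows "AE \<omega> in M. \<exists>K. \<forall>n. (\<integral>\<^sup>+s. ennreal (exp ((scaled_increment H (\<lambda>t. X t \<omega>) ((1 / 2) ^ n) s)\<^sup>2 / 20))
      \<partial>restrict_space lborel {0..1}) \<le> ennreal K"
proof -
  define h :: "nat \<Rightarrow> real" where "h n = (1 / 2) ^ n" for n
  have h: "0 < h n" for n by (simp add: h_def)
  define Z where "Z n \<omega> = (\<integral>\<^sup>+s. ennreal (exp ((scaled_increment H (\<lambda>t. X t \<omega>) (h n) s)\<^sup>2 / 20))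
      \<partial>restrict_space lborel {0..1})" for n \<omega>
  note moments = exp_energy_moments[OF H X meas cont h, folded Z_def]
  define m where "m n = enn2real (\<integral>\<^sup>+\<omega>. Z n \<omega> \<partial>M)" for n
  have m: "(\<integral>\<^sup>+\<omega>. Z n \<omega> \<partial>M) = ennreal (m n)" for n
    using le_less_trans[OF moments(2)[of n] ennreal_less_top] by (simp add: m_def)
  have "AE \<omega> in M. \<exists>K. \<forall>n. Z n \<omega> \<le> ennreal K"
  proof (rule AE_bounded_if_summable_variances)
    show "Z n \<in> borel_measurable M" for n by (rule moments)
    show "(\<integral>\<^sup>+\<omega>. Z n \<omega> \<partial>M) = ennreal (m n)" for n by (rule m)
    show "0 \<le> m n" for n by (simp add: m_def)
    show "m n \<le> sqrt 2" for n
      using moments(2)[of n] unfolding m by simp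
    show "(\<integral>\<^sup>+\<omega>. Z n \<omega> * Z n \<omega> \<partial>M)
        \<le> ennreal (m n) * ennreal (m n) + ennreal (8 * sqrt (h n) + 16 * h n powr (1 - H))" for n
      using moments(3)[of n] unfolding m .
    show "0 \<le> 8 * sqrt (h n) + 16 * h n powr (1 - H)" for n using h[of n] by simp
    show "summable (\<lambda>n. 8 * sqrt (h n) + 16 * h n powr (1 - H))"
    proof -
      have "sqrt (h n) = (sqrt (1 / 2)) ^ n" for n by (simp add: h_def real_sqrt_power)
      moreover have "h n powr (1 - H) = ((1 / 2) powr (1 - H)) ^ n" for n
        by (simp add: h_def powr_powr mult.commute flip: powr_realpow)
      moreover have "(1 / 2 :: real) powr (1 - H) < 1"
        using H powr_less_mono2[of "1 - H" "1 / 2" 1] by simp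
      moreover have "sqrt (1 / 2) < (1::real)" by simp
      ultimately show ?thesis
        by (simp add: summable_add summable_mult summable_geometric)
    qed
  qed
  then show ?thesis by (simp add: Z_def h_def)
qed

section \<open>From dyadic to arbitrary increments\<close>

text \<open>
  Jensen's inequality, first for the square and then for the exponential.
\<close>

lemma exp_square_sum_le:
  fixes a y :: "'i \<Rightarrow> real"
  assumes "finite I" "\<And>i. i \<in> I \<Longrightarrow> 0 \<le> a i" "sum a I = 1"
  shows "exp ((\<Sum>i\<in>I. a i * y i)\<^sup>2 / 20) \<le> (\<Sum>i\<in>I. a i * exp ((y i)\<^sup>2 / 20))"
proof -
  have I: "I \<noteq> {}" using assms(3) by auto
  have "(\<Sum>i\<in>I. a i *\<^sub>R y i)\<^sup>2 \<le> (\<Sum>i\<in>I. a i * (y i)\<^sup>2)"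
    using assms I by (intro convex_on_sum[OF _ _ convex_power2]) auto
  then have "(\<Sum>i\<in>I. a i * y i)\<^sup>2 / 20 \<le> (\<Sum>i\<in>I. a i * ((y i)\<^sup>2 / 20))"
    by (simp add: sum_divide_distrib[symmetric])
  then have "exp ((\<Sum>i\<in>I. a i * y i)\<^sup>2 / 20) \<le> exp (\<Sum>i\<in>I. a i *\<^sub>R ((y i)\<^sup>2 / 20))"
    by simp
  also have "\<dots> \<le> (\<Sum>i\<in>I. a i * exp ((y i)\<^sup>2 / 20))"
    using assms I by (intro convex_on_sum[OF _ _ exp_convex]) auto
  finally show ?thesis .
qed

lemma exp_square_mono:
  fixes x y :: real
  assumes "\<bar>x\<bar> \<le> \<bar>y\<bar>"
  shows "exp (x\<^sup>2 / 20) \<le> exp (y\<^sup>2 / 20)"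
  using power_mono[OF assms, of 2] by simp

lemma abs_divide_antimono:
  fixes x b c :: real
  shows "0 < b \<Longrightarrow> b \<le> c \<Longrightarrow> \<bar>x / c\<bar> \<le> \<bar>x / b\<bar>"
  by (simp add: abs_divide frac_le)

lemma nn_integral_translate:
  fixes g :: "real \<Rightarrow> ennreal"
  assumes "g \<in> borel_measurable borel"
  shows "(\<integral>\<^sup>+s. g (s + c) \<partial>lborel) = (\<integral>\<^sup>+s. g s \<partial>lborel)"
  using nn_integral_real_affine[OF assms, of 1 c] by (simp add: add.commute)

lemma two_powr_minus_less_1: "0 < H \<Longrightarrow> 2 powr - H < (1 :: real)"
  using powr_less_mono[of "- H" 0 "2 :: real"] by simp

lemma half_power_powr: "((1 / 2 :: real) ^ k) powr a = (2 powr - a) ^ k"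
proof -
  have "(1 / 2 :: real) ^ k = 2 powr (- real k)"
    by (simp add: powr_minus_divide powr_realpow power_one_over)
  then have "((1 / 2 :: real) ^ k) powr a = 2 powr (real k * - a)"
    by (simp only: powr_powr) (simp add: mult.commute)
  also have "\<dots> = (2 powr - a) ^ k" by (rule powr_power[symmetric]) simp
  finally show ?thesis .
qed

text \<open>
  The partial sums of the binary expansion of \<open>h\<close>.
\<close>

definition dyadic_floor :: "real \<Rightarrow> nat \<Rightarrow> real" where
  "dyadic_floor h k = of_int \<lfloor>2 ^ k * h\<rfloor> / 2 ^ k"

lemma dyadic_floor_le: "dyadic_floor h k \<le> h"
proof -
  have "of_int \<lfloor>2 ^ k * h\<rfloor> \<le> 2 ^ k * h" by (rule of_int_floor_le)
  then show ?thesis by (simp add: dyadic_floor_def field_simps)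
qed

lemma dyadic_floor_ge: "h - (1 / 2) ^ k \<le> dyadic_floor h k"
proof -
  have "2 ^ k * h - 1 \<le> of_int \<lfloor>2 ^ k * h\<rfloor>" by linarith
  then have "(2 ^ k * h - 1) / 2 ^ k \<le> dyadic_floor h k"
    unfolding dyadic_floor_def by (rule divide_right_mono) simp
  then show ?thesis by (simp add: diff_divide_distrib power_divide)
qed

lemma dyadic_floor_nonneg: "0 \<le> h \<Longrightarrow> 0 \<le> dyadic_floor h k"
  by (simp add: dyadic_floor_def)

lemma dyadic_floor_eq_0: "0 \<le> h \<Longrightarrow> h < (1 / 2) ^ k \<Longrightarrow> dyadic_floor h k = 0"
proof -
  assume h: "0 \<le> h" "h < (1 / 2) ^ k"
  then have "2 ^ k * h < 1" by (simp add: field_simps power_divide)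
  moreover have "0 \<le> 2 ^ k * h" using h by simp
  ultimately have "\<lfloor>2 ^ k * h\<rfloor> = 0" by (simp add: floor_eq_iff)
  then show ?thesis by (simp add: dyadic_floor_def)
qed

lemma dyadic_floor_Suc:
  "dyadic_floor h (Suc k) = dyadic_floor h k \<or>
    dyadic_floor h (Suc k) = dyadic_floor h k + (1 / 2) ^ Suc k"
proof -
  define x where "x = 2 ^ k * h"
  have "\<lfloor>2 * x\<rfloor> = 2 * \<lfloor>x\<rfloor> \<or> \<lfloor>2 * x\<rfloor> = 2 * \<lfloor>x\<rfloor> + 1" by linarith
  moreover have "2 ^ Suc k * h = 2 * x" by (simp add: x_def)
  ultimately show ?thesis
    unfolding dyadic_floor_def x_def[symmetric]
    by (auto simp: field_simps power_divide)
qed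

lemma dyadic_floor_tendsto: "dyadic_floor h \<longlonglongrightarrow> h"
proof (rule tendsto_sandwich)
  have "(\<lambda>k. (1 / 2 :: real) ^ k) \<longlonglongrightarrow> 0" by (rule LIMSEQ_power_zero) simp
  from tendsto_diff[OF tendsto_const this, of h] show "(\<lambda>k. h - (1 / 2) ^ k) \<longlonglongrightarrow> h" by simp
qed (auto simp: dyadic_floor_ge dyadic_floor_le)

text \<open>
  An increment over \<open>h\<close> is the sum of the increments over the binary digits of \<open>h\<close>, and the digit of
  scale \<open>(1/2) ^ k\<close> contributes with weight \<open>q ^ k = ((1/2) ^ k) powr H\<close>. The first nonzero digit has
  scale at most \<open>h\<close>, hence the weights sum up to at most \<open>h powr H / (1 - q)\<close>. Normalised, they form a
  convex combination, so that Jensen's inequality carries the bound \<open>K\<close> over from dyadic increments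
  without loss. Continuity of \<open>f\<close> and Fatou's lemma cover infinitely many digits.
\<close>

lemma nn_integral_exp_increment_le:
  fixes f :: "real \<Rightarrow> real"
  assumes H: "0 < H" and cont: "continuous_on UNIV f"
    and K: "\<And>n. (\<integral>\<^sup>+s. ennreal (exp ((scaled_increment H f ((1 / 2) ^ n) s)\<^sup>2 / 20))
      \<partial>restrict_space lborel {0..1}) \<le> ennreal K"
    and h: "0 < h" "h < 1"
  shows "(\<integral>\<^sup>+s. ennreal (exp (((f (s + h) - f s) / (h powr H / (1 - 2 powr - H)))\<^sup>2 / 20))
      * indicator {0<..<1 - h} s \<partial>lborel) \<le> ennreal K"
proof -
  define q where "q = 2 powr - H"
  have q: "0 < q" "q < 1" using H by (simp_all add: q_def two_powr_minus_less_1)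
  have [measurable]: "f \<in> borel_measurable borel" using cont by (rule borel_measurable_continuous_onI)
  let ?d = "dyadic_floor h" and ?I = "{0<..<1 - h}"
  have scal: "scaled_increment H f ((1 / 2) ^ k) s = (f (s + (1 / 2) ^ k) - f s) / q ^ k" for k s
  proof -
    have e: "((1 / 2) ^ k) powr (- H) = inverse (q ^ k)"
      by (simp only: half_power_powr q_def minus_minus) (simp add: powr_minus power_inverse)
    show ?thesis
      unfolding scaled_increment_def e by (rule trans[OF mult.commute divide_inverse[symmetric]])
  qed
  have K': "(\<integral>\<^sup>+s. ennreal (exp (((f (s + (1 / 2) ^ k) - f s) / q ^ k)\<^sup>2 / 20)) * indicator {0..1} s \<partial>lborel)
      \<le> ennreal K" for k
    using K[of k] by (subst (asm) nn_integral_restrict_space) (simp_all add: scal)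
  have K1: "1 \<le> ennreal K"
  proof -
    have "1 = (\<integral>\<^sup>+s. indicator {0..1::real} s \<partial>lborel)" by simp
    also have "\<dots> \<le> (\<integral>\<^sup>+s. ennreal (exp (((f (s + (1 / 2) ^ 0) - f s) / q ^ 0)\<^sup>2 / 20)) * indicator {0..1} s \<partial>lborel)"
    proof (intro nn_integral_mono)
      fix s :: real
      have "ennreal 1 \<le> ennreal (exp (((f (s + (1 / 2) ^ 0) - f s) / q ^ 0)\<^sup>2 / 20))"
        by (rule ennreal_leI) simp
      then show "indicator {0..1} s \<le> ennreal (exp (((f (s + (1 / 2) ^ 0) - f s) / q ^ 0)\<^sup>2 / 20)) * indicator {0..1} s"
        by (simp split: split_indicator)
    qed
    also note K'[of 0]
    finally show ?thesis .
  qed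
  \<comment> \<open>The first nonzero binary digit of \<open>h\<close> is the one of scale \<open>(1 / 2) ^ Suc m\<close>.\<close>
  obtain m where m: "h < (1 / 2) ^ m" "(1 / 2) ^ Suc m \<le> h"
  proof -
    have "\<exists>n. (1 / 2) ^ n < h" using h by (intro real_arch_pow_inv) auto
    then have ex: "\<exists>n. (1 / 2) ^ n \<le> h" using less_imp_le by blast
    define n where "n = (LEAST n. (1 / 2) ^ n \<le> h)"
    have n: "(1 / 2) ^ n \<le> h" unfolding n_def using ex by (rule LeastI_ex)
    then obtain j where j: "n = Suc j" using h by (cases n) auto
    have "\<not> (1 / 2) ^ j \<le> h"
      using not_less_Least[of j "\<lambda>n. (1 / 2) ^ n \<le> h"] j by (simp add: n_def)
    then show ?thesis using that[of j] n j by simp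
  qed
  define y where "y k s = (f (s + ?d k) - f (s + ?d (k - 1))) / q ^ k" for k s
  have y: "(\<integral>\<^sup>+s. ennreal (exp ((y k s)\<^sup>2 / 20)) * indicator ?I s \<partial>lborel) \<le> ennreal K"
    if "k \<noteq> 0" for k
  proof -
    obtain j where j: "k = Suc j" using \<open>k \<noteq> 0\<close> by (cases k) auto
    \<comment> \<open>The digit of scale \<open>(1 / 2) ^ k\<close> is 0 or 1; in the first case the increment vanishes.\<close>
    consider "?d k = ?d j" | "?d k = ?d j + (1 / 2) ^ k"
      using dyadic_floor_Suc[of h j] j by auto
    then show ?thesis
    proof cases
      case 1
      then have "(\<integral>\<^sup>+s. ennreal (exp ((y k s)\<^sup>2 / 20)) * indicator ?I s \<partial>lborel) = ennreal (1 - h)"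
        using h by (simp add: y_def j)
      also have "\<dots> \<le> 1" using h by (simp add: ennreal_le_1)
      finally show ?thesis using K1 by order
    next
      case 2
      define g where "g s = ennreal (exp (((f (s + (1 / 2) ^ k) - f s) / q ^ k)\<^sup>2 / 20)) * indicator {0..1} s" for s
      have [measurable]: "g \<in> borel_measurable borel" unfolding g_def by measurable
      have "(\<integral>\<^sup>+s. ennreal (exp ((y k s)\<^sup>2 / 20)) * indicator ?I s \<partial>lborel) \<le> (\<integral>\<^sup>+s. g (s + ?d j) \<partial>lborel)"
      proof (intro nn_integral_mono)
        fix s :: real
        have "s + ?d j \<in> {0..1}" if "s \<in> ?I"
          using that dyadic_floor_nonneg[of h j] dyadic_floor_le[of h j] h by auto
        then show "ennreal (exp ((y k s)\<^sup>2 / 20)) * indicator ?I s \<le> g (s + ?d j)"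
          using 2 by (auto simp: g_def y_def j add.assoc split: split_indicator)
      qed
      also have "\<dots> = (\<integral>\<^sup>+s. g s \<partial>lborel)" by (rule nn_integral_translate) measurable
      also have "\<dots> \<le> ennreal K" unfolding g_def by (rule K')
      finally show ?thesis .
    qed
  qed
  define B where "B = h powr H / (1 - q)"
  have B: "0 < B" using h q by (simp add: B_def)
  define u where "u N s = ennreal (exp (((f (s + ?d (N + Suc m)) - f s) / B)\<^sup>2 / 20)) * indicator ?I s" for N s
  have u: "(\<integral>\<^sup>+s. u N s \<partial>lborel) \<le> ennreal K" for N
  proof -
    define J where "J = {Suc m..N + Suc m}"
    have J: "finite J" "\<And>k. k \<in> J \<Longrightarrow> k \<noteq> 0" by (auto simp: J_def)
    define W where "W = (\<Sum>k\<in>J. q ^ k)"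
    have W0: "0 < W" unfolding W_def using q by (intro sum_pos) (auto simp: J_def)
    have "W \<le> B"
    proof -
      have "W = q ^ Suc m * (\<Sum>k\<le>N. q ^ k)"
        unfolding W_def J_def using sum.shift_bounds_cl_nat_ivl[of "\<lambda>k. q ^ k" 0 "Suc m" N]
        by (simp add: power_add sum_distrib_left atLeast0AtMost mult_ac)
      also have "\<dots> \<le> q ^ Suc m * (1 / (1 - q))"
      proof -
        have "(\<Sum>k\<le>N. q ^ k) \<le> (\<Sum>k. q ^ k)"
          using q by (intro sum_le_suminf summable_geometric) auto
        then have "(\<Sum>k\<le>N. q ^ k) \<le> 1 / (1 - q)" using q by (simp add: suminf_geometric)
        then show ?thesis using q by (intro mult_left_mono) auto
      qed
      also have "\<dots> \<le> h powr H * (1 / (1 - q))"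
      proof -
        have "q ^ Suc m = ((1 / 2) ^ Suc m) powr H"
          unfolding q_def by (rule half_power_powr[symmetric])
        also have "\<dots> \<le> h powr H" using m H by (intro powr_mono2) auto
        finally show ?thesis using q by (intro mult_right_mono) auto
      qed
      finally show ?thesis by (simp add: B_def)
    qed
    have tele: "f (s + ?d (N + Suc m)) - f s = (\<Sum>k\<in>J. q ^ k * y k s)" for s
    proof -
      have "(\<Sum>k\<in>J. q ^ k * y k s) = (\<Sum>k\<in>{Suc m..N + Suc m}. f (s + ?d k) - f (s + ?d (k - 1)))"
        unfolding J_def using q by (intro sum.cong refl) (simp add: y_def)
      also have "\<dots> = f (s + ?d (N + Suc m)) - f (s + ?d m)"
        by (rule sum_telescope'') simp
      also have "?d m = 0" using h m by (intro dyadic_floor_eq_0) auto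
      finally show ?thesis by simp
    qed
    have "u N s \<le> (\<Sum>k\<in>J. ennreal (q ^ k / W) * (ennreal (exp ((y k s)\<^sup>2 / 20)) * indicator ?I s))" for s
    proof -
      have "\<bar>(f (s + ?d (N + Suc m)) - f s) / B\<bar> \<le> \<bar>(f (s + ?d (N + Suc m)) - f s) / W\<bar>"
        using W0 \<open>W \<le> B\<close> by (rule abs_divide_antimono)
      then have "exp (((f (s + ?d (N + Suc m)) - f s) / B)\<^sup>2 / 20) \<le> exp (((f (s + ?d (N + Suc m)) - f s) / W)\<^sup>2 / 20)"
        by (rule exp_square_mono)
      also have "(f (s + ?d (N + Suc m)) - f s) / W = (\<Sum>k\<in>J. q ^ k / W * y k s)"
        unfolding tele by (simp add: sum_divide_distrib)
      also have "exp ((\<Sum>k\<in>J. q ^ k / W * y k s)\<^sup>2 / 20) \<le> (\<Sum>k\<in>J. q ^ k / W * exp ((y k s)\<^sup>2 / 20))"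
        using q W0 J by (intro exp_square_sum_le) (auto simp: W_def simp flip: sum_divide_distrib)
      finally have "ennreal (exp (((f (s + ?d (N + Suc m)) - f s) / B)\<^sup>2 / 20))
          \<le> ennreal (\<Sum>k\<in>J. q ^ k / W * exp ((y k s)\<^sup>2 / 20))" by (rule ennreal_leI)
      also have "\<dots> = (\<Sum>k\<in>J. ennreal (q ^ k / W) * ennreal (exp ((y k s)\<^sup>2 / 20)))"
      proof -
        have "ennreal (\<Sum>k\<in>J. q ^ k / W * exp ((y k s)\<^sup>2 / 20)) = (\<Sum>k\<in>J. ennreal (q ^ k / W * exp ((y k s)\<^sup>2 / 20)))"
          using q W0 by (intro sum_ennreal[symmetric]) simp
        also have "\<dots> = (\<Sum>k\<in>J. ennreal (q ^ k / W) * ennreal (exp ((y k s)\<^sup>2 / 20)))"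
          using q W0 by (intro sum.cong refl ennreal_mult) simp_all
        finally show ?thesis .
      qed
      finally show ?thesis
        by (auto simp: u_def split: split_indicator)
    qed
    then have "(\<integral>\<^sup>+s. u N s \<partial>lborel)
        \<le> (\<integral>\<^sup>+s. (\<Sum>k\<in>J. ennreal (q ^ k / W) * (ennreal (exp ((y k s)\<^sup>2 / 20)) * indicator ?I s)) \<partial>lborel)"
      by (intro nn_integral_mono)
    also have "\<dots> = (\<Sum>k\<in>J. ennreal (q ^ k / W) * (\<integral>\<^sup>+s. ennreal (exp ((y k s)\<^sup>2 / 20)) * indicator ?I s \<partial>lborel))"
      unfolding y_def by (simp add: nn_integral_sum nn_integral_cmult)
    also have "\<dots> \<le> (\<Sum>k\<in>J. ennreal (q ^ k / W) * ennreal K)"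
      by (intro sum_mono mult_left_mono y J) auto
    also have "\<dots> = ennreal (\<Sum>k\<in>J. q ^ k / W) * ennreal K"
      using q W0 by (simp add: sum_distrib_right[symmetric])
    also have "(\<Sum>k\<in>J. q ^ k / W) = 1"
      using W0 by (simp add: W_def flip: sum_divide_distrib)
    finally show ?thesis by simp
  qed
  have lim: "(\<lambda>N. u N s) \<longlonglongrightarrow> ennreal (exp (((f (s + h) - f s) / B)\<^sup>2 / 20)) * indicator ?I s" for s
  proof -
    have "(\<lambda>N. f (s + ?d (N + Suc m))) \<longlonglongrightarrow> f (s + h)"
    proof (rule isCont_tendsto_compose[where g = f])
      show "isCont f (s + h)" using cont by (simp add: continuous_on_eq_continuous_at)
      show "(\<lambda>N. s + ?d (N + Suc m)) \<longlonglongrightarrow> s + h"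
        by (intro tendsto_add tendsto_const LIMSEQ_ignore_initial_segment dyadic_floor_tendsto)
    qed
    then have "(\<lambda>N. exp (((f (s + ?d (N + Suc m)) - f s) / B)\<^sup>2 / 20)) \<longlonglongrightarrow> exp (((f (s + h) - f s) / B)\<^sup>2 / 20)"
      using B by (intro tendsto_intros) auto
    then show ?thesis
      by (cases "s \<in> ?I") (simp_all add: u_def tendsto_ennrealI)
  qed
  have "(\<integral>\<^sup>+s. ennreal (exp (((f (s + h) - f s) / B)\<^sup>2 / 20)) * indicator ?I s \<partial>lborel)
      = (\<integral>\<^sup>+s. liminf (\<lambda>N. u N s) \<partial>lborel)"
    by (intro nn_integral_cong lim_imp_Liminf[symmetric] lim) simp
  also have "\<dots> \<le> liminf (\<lambda>N. \<integral>\<^sup>+s. u N s \<partial>lborel)"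
    unfolding u_def by (intro nn_integral_liminf) measurable
  also have "\<dots> \<le> limsup (\<lambda>N. \<integral>\<^sup>+s. u N s \<partial>lborel)"
    by (rule Liminf_le_Limsup) simp
  also have "\<dots> \<le> ennreal K"
    by (rule Limsup_bounded) (simp add: u)
  finally show ?thesis by (simp add: B_def q_def)
qed

lemma shift_ivl_pos: "0 \<le> h \<Longrightarrow> shift_ivl h = {0<..<1 - h}"
  by (auto simp: shift_ivl_def unit_ivl_def)

lemma shift_ivl_neg: "0 \<le> h \<Longrightarrow> shift_ivl (- h) = {h<..<1}"
  by (auto simp: shift_ivl_def unit_ivl_def)

text \<open>
  A negative shift turns into a positive one by a translation of the variable, since the integrand
  depends only on the square of the increment.
\<close>

lemma nn_integral_exp_shift_le:
  fixes f :: "real \<Rightarrow> real"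
  assumes H: "0 < H" and cont: "continuous_on UNIV f"
    and K: "\<And>n. (\<integral>\<^sup>+s. ennreal (exp ((scaled_increment H f ((1 / 2) ^ n) s)\<^sup>2 / 20))
      \<partial>restrict_space lborel {0..1}) \<le> ennreal K"
    and K1: "1 \<le> K" and t: "0 < t" "\<bar>h\<bar> \<le> t"
  shows "(\<integral>\<^sup>+s. ennreal (exp (((f (s + h) - f s) / (t powr H / (1 - 2 powr - H)))\<^sup>2 / 20))
      * indicator (shift_ivl h) s \<partial>lborel) \<le> ennreal K"
proof -
  define A where "A = 1 - 2 powr - H"
  have A: "0 < A" using H by (simp add: A_def two_powr_minus_less_1)
  have [measurable]: "f \<in> borel_measurable borel" using cont by (rule borel_measurable_continuous_onI)
  have pos: "(\<integral>\<^sup>+s. ennreal (exp (((f (s + h) - f s) / (t powr H / A))\<^sup>2 / 20))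
      * indicator (shift_ivl h) s \<partial>lborel) \<le> ennreal K" if h: "0 \<le> h" "h \<le> t" for h
  proof -
    consider "h = 0" | "1 \<le> h" | "0 < h" "h < 1" using h by linarith
    then show ?thesis
    proof cases
      case 1
      then have "(\<integral>\<^sup>+s. ennreal (exp (((f (s + h) - f s) / (t powr H / A))\<^sup>2 / 20))
          * indicator (shift_ivl h) s \<partial>lborel) = 1"
        by (simp add: shift_ivl_pos)
      then show ?thesis using K1 by (simp add: ennreal_ge_1)
    next
      case 2
      then show ?thesis by (simp add: shift_ivl_pos)
    next
      case 3
      have "\<bar>(f (s + h) - f s) / (t powr H / A)\<bar> \<le> \<bar>(f (s + h) - f s) / (h powr H / A)\<bar>" for s
      proof -
        have "h powr H / A \<le> t powr H / A"
          using H A h 3 by (intro divide_right_mono powr_mono2) auto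
        moreover have "0 < h powr H / A" using A 3 by simp
        ultimately show ?thesis by (intro abs_divide_antimono)
      qed
      then have "exp (((f (s + h) - f s) / (t powr H / A))\<^sup>2 / 20)
          \<le> exp (((f (s + h) - f s) / (h powr H / A))\<^sup>2 / 20)" for s
        by (rule exp_square_mono)
      then have "(\<integral>\<^sup>+s. ennreal (exp (((f (s + h) - f s) / (t powr H / A))\<^sup>2 / 20)) * indicator (shift_ivl h) s \<partial>lborel)
          \<le> (\<integral>\<^sup>+s. ennreal (exp (((f (s + h) - f s) / (h powr H / A))\<^sup>2 / 20)) * indicator (shift_ivl h) s \<partial>lborel)"
        by (intro nn_integral_mono mult_right_mono ennreal_leI) auto
      also have "\<dots> \<le> ennreal K"
        unfolding shift_ivl_pos[OF h(1)] A_def using H cont K 3 by (rule nn_integral_exp_increment_le)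
      finally show ?thesis .
    qed
  qed
  show ?thesis
  proof (cases "0 \<le> h")
    case True
    then show ?thesis using pos[of h] t by (simp add: A_def)
  next
    case False
    define k where "k = - h"
    have k: "0 \<le> k" "k \<le> t" "h = - k" using False t by (auto simp: k_def)
    define g where "g s = ennreal (exp (((f (s - k) - f s) / (t powr H / A))\<^sup>2 / 20)) * indicator (shift_ivl (- k)) s" for s
    have [measurable]: "g \<in> borel_measurable borel" unfolding g_def shift_ivl_neg[OF k(1)] by measurable
    have "(\<integral>\<^sup>+s. g s \<partial>lborel) = (\<integral>\<^sup>+s. g (s + k) \<partial>lborel)"
      by (rule nn_integral_translate[symmetric]) measurable
    also have "\<dots> = (\<integral>\<^sup>+s. ennreal (exp (((f (s + k) - f s) / (t powr H / A))\<^sup>2 / 20)) * indicator (shift_ivl k) s \<partial>lborel)"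
    proof (intro nn_integral_cong)
      fix s
      have "((f (s + k) - f s) / (t powr H / A))\<^sup>2 = ((f s - f (s + k)) / (t powr H / A))\<^sup>2"
        by (simp only: power_divide power2_commute[of "f (s + k)"])
      then show "g (s + k) = ennreal (exp (((f (s + k) - f s) / (t powr H / A))\<^sup>2 / 20)) * indicator (shift_ivl k) s"
        unfolding g_def shift_ivl_neg[OF k(1)] shift_ivl_pos[OF k(1)]
        by (simp split: split_indicator)
    qed
    also have "\<dots> \<le> ennreal K" using k by (intro pos)
    finally show ?thesis by (simp add: g_def k A_def)
  qed
qed

section \<open>Membership in the Besov-Orlicz space\<close>

text \<open>
  Raise \<open>z \<le> exp z\<close> with \<open>z = x\<^sup>2 / (20 * p)\<close> to the power \<open>p / 2\<close>.
\<close>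

lemma powr_le_exp_square:
  fixes x p :: real
  assumes "0 < p"
  shows "\<bar>x\<bar> powr p \<le> (20 * p) powr (p / 2) * exp (x\<^sup>2 / 20)"
proof -
  have "x\<^sup>2 / (20 * p) \<le> exp (x\<^sup>2 / (20 * p))"
    using exp_ge_add_one_self[of "x\<^sup>2 / (20 * p)"] by linarith
  then have "(x\<^sup>2 / (20 * p)) powr (p / 2) \<le> exp (x\<^sup>2 / (20 * p)) powr (p / 2)"
    using assms by (intro powr_mono2) auto
  also have "\<dots> = exp (x\<^sup>2 / 40)"
    using assms by (simp add: exp_powr_real)
  also have "\<dots> \<le> exp (x\<^sup>2 / 20)" by simp
  finally have *: "(x\<^sup>2 / (20 * p)) powr (p / 2) \<le> exp (x\<^sup>2 / 20)" .
  have "\<bar>x\<bar> powr p = (x\<^sup>2) powr (p / 2)"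
  proof -
    have "(\<bar>x\<bar> powr 2) powr (p / 2) = \<bar>x\<bar> powr p" by (simp only: powr_powr) simp
    then show ?thesis by simp
  qed
  also have "\<dots> = (20 * p) powr (p / 2) * (x\<^sup>2 / (20 * p)) powr (p / 2)"
    using assms by (simp flip: powr_mult)
  also have "\<dots> \<le> (20 * p) powr (p / 2) * exp (x\<^sup>2 / 20)"
    using * by (intro mult_left_mono) auto
  finally show ?thesis .
qed

text \<open>
  Integrating \<open>powr_le_exp_square\<close> bounds the \<open>p\<close>-norm of \<open>g\<close> by
  \<open>B * sqrt (20 * p) * K powr (1 / p)\<close>: exactly the growth \<open>sqrt p\<close> that the norm permits.
\<close>

lemma Phi2_norm_le_if_exp_integrable:
  fixes g :: "real \<Rightarrow> real"
  assumes [measurable]: "J \<in> sets borel" "g \<in> borel_measurable borel" and B: "0 < B" and K: "1 \<le> K"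
    and int: "(\<integral>\<^sup>+s. ennreal (exp ((g s / B)\<^sup>2 / 20)) * indicator J s \<partial>lborel) \<le> ennreal K"
  shows "Phi2_norm J g \<le> ennreal (B * sqrt 20 * K)"
  unfolding Phi2_norm_def
proof (rule SUP_least)
  fix p :: real assume "p \<in> {1..}"
  then have p: "1 \<le> p" by simp
  define i where "i = (\<integral>\<^sup>+x. ennreal (\<bar>g x\<bar> powr p) \<partial>lebesgue_on J)"
  define c where "c = B powr p * (20 * p) powr (p / 2)"
  have c: "0 \<le> c" by (simp add: c_def)
  have "i = (\<integral>\<^sup>+x. ennreal (\<bar>g x\<bar> powr p) * indicator J x \<partial>lebesgue)"
    unfolding i_def by (rule nn_integral_restrict_space) simp
  also have "\<dots> = (\<integral>\<^sup>+x. ennreal (\<bar>g x\<bar> powr p) * indicator J x \<partial>lborel)"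
    by (rule nn_integral_completion)
  also have "\<dots> \<le> (\<integral>\<^sup>+x. ennreal c * (ennreal (exp ((g x / B)\<^sup>2 / 20)) * indicator J x) \<partial>lborel)"
  proof (intro nn_integral_mono)
    fix x
    have "\<bar>g x\<bar> powr p = B powr p * \<bar>g x / B\<bar> powr p"
      using B by (simp add: abs_divide flip: powr_mult)
    also have "\<dots> \<le> B powr p * ((20 * p) powr (p / 2) * exp ((g x / B)\<^sup>2 / 20))"
      using p by (intro mult_left_mono powr_le_exp_square) auto
    finally have "ennreal (\<bar>g x\<bar> powr p) \<le> ennreal (c * exp ((g x / B)\<^sup>2 / 20))"
      by (intro ennreal_leI) (simp add: c_def mult.assoc)
    then show "ennreal (\<bar>g x\<bar> powr p) * indicator J x \<le> ennreal c * (ennreal (exp ((g x / B)\<^sup>2 / 20)) * indicator J x)"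
      using c by (auto simp: ennreal_mult split: split_indicator)
  qed
  also have "\<dots> \<le> ennreal c * ennreal K"
    using int by (subst nn_integral_cmult) (auto intro: mult_left_mono)
  finally have i: "i \<le> ennreal (c * K)" using c K by (simp add: ennreal_mult)
  have cK: "0 \<le> c * K" using c K by simp
  have "i \<noteq> \<infinity>" using i by (auto simp: top_unique)
  have "enn2real i \<le> c * K"
    using enn2real_mono[OF i] cK by simp
  then have "enn2real i powr (1 / p) \<le> (c * K) powr (1 / p)"
    using p by (intro powr_mono2) auto
  also have "\<dots> = B * sqrt (20 * p) * K powr (1 / p)"
    using p B K by (simp add: c_def powr_mult powr_powr powr_half_sqrt real_sqrt_mult)
  also have "\<dots> \<le> B * sqrt (20 * p) * K powr 1"
    using p B K by (intro mult_left_mono powr_mono) auto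
  finally have le: "enn2real i powr (1 / p) \<le> B * sqrt (20 * p) * K" using K by simp
  have "ennreal (p powr (- 1 / 2)) * Lp_norm J p g = ennreal (p powr (- 1 / 2) * enn2real i powr (1 / p))"
    unfolding Lp_norm_def i_def[symmetric] Let_def using \<open>i \<noteq> \<infinity>\<close> by (simp add: ennreal_mult)
  also have "\<dots> \<le> ennreal (p powr (- 1 / 2) * (B * sqrt (20 * p) * K))"
    using le by (intro ennreal_leI mult_left_mono) auto
  also have "p powr (- 1 / 2) * (B * sqrt (20 * p) * K) = B * sqrt 20 * K"
  proof -
    have "p powr (- 1 / 2) * sqrt p = 1"
      using p powr_minus[of p "1 / 2"] by (simp add: powr_half_sqrt)
    then show ?thesis by (simp add: real_sqrt_mult mult_ac)
  qed
  finally show "ennreal (p powr (- 1 / 2)) * Lp_norm J p g \<le> ennreal (B * sqrt 20 * K)" .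
qed

text \<open>
  The hypothesis controls the increments; the norm of \<open>f\<close> itself is finite since \<open>f\<close> is bounded on the
  compact interval.
\<close>

lemma besov_orlicz_if_dyadic:
  fixes f :: "real \<Rightarrow> real"
  assumes H: "0 < H" and cont: "continuous_on UNIV f"
    and K0: "\<And>n. (\<integral>\<^sup>+s. ennreal (exp ((scaled_increment H f ((1 / 2) ^ n) s)\<^sup>2 / 20))
      \<partial>restrict_space lborel {0..1}) \<le> ennreal K0"
  shows "f \<in> besov_orlicz H"
proof -
  define K where "K = max 1 K0"
  have K1: "1 \<le> K" by (simp add: K_def)
  have K: "(\<integral>\<^sup>+s. ennreal (exp ((scaled_increment H f ((1 / 2) ^ n) s)\<^sup>2 / 20))
      \<partial>restrict_space lborel {0..1}) \<le> ennreal K" for n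
    using K0[of n] by (rule order_trans) (simp add: K_def ennreal_leI)
  have [measurable]: "f \<in> borel_measurable borel" using cont by (rule borel_measurable_continuous_onI)
  have "f \<in> borel_measurable (lebesgue_on unit_ivl)"
    by (intro measurable_restrict_space1 measurable_completion) simp
  moreover have "Phi2_norm unit_ivl f < \<infinity>"
  proof -
    have "compact (f ` {0..1})" using cont by (intro compact_continuous_image continuous_on_subset[OF cont]) auto
    then obtain b where b: "0 < b" "\<And>s. s \<in> {0..1} \<Longrightarrow> \<bar>f s\<bar> \<le> b"
      using compact_imp_bounded bounded_pos by (metis imageI real_norm_def)
    have "(\<integral>\<^sup>+s. ennreal (exp ((f s / b)\<^sup>2 / 20)) * indicator unit_ivl s \<partial>lborel)
        \<le> (\<integral>\<^sup>+s. ennreal (exp 1) * indicator unit_ivl s \<partial>lborel)"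
    proof (intro nn_integral_mono)
      fix s
      have "exp ((f s / b)\<^sup>2 / 20) \<le> exp 1" if "s \<in> unit_ivl"
      proof -
        have "\<bar>f s / b\<bar> \<le> 1" using b(2)[of s] b(1) that by (simp add: unit_ivl_def)
        then have "(f s / b)\<^sup>2 \<le> 1" by (simp add: abs_square_le_1)
        then show ?thesis by simp
      qed
      then show "ennreal (exp ((f s / b)\<^sup>2 / 20)) * indicator unit_ivl s \<le> ennreal (exp 1) * indicator unit_ivl s"
        by (auto split: split_indicator intro: ennreal_leI)
    qed
    also have "\<dots> = ennreal (exp 1)" by (simp add: unit_ivl_def nn_integral_cmult)
    finally have "Phi2_norm unit_ivl f \<le> ennreal (b * sqrt 20 * exp 1)"
      using b(1) by (intro Phi2_norm_le_if_exp_integrable) (auto simp: unit_ivl_def)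
    then show ?thesis by (simp add: le_less_trans)
  qed
  moreover have "(SUP t\<in>{0<..1}. ennreal (t powr (- H)) *
            (SUP h\<in>{h. \<bar>h\<bar> \<le> t}. Phi2_norm (shift_ivl h) (\<lambda>s. f (s + h) - f s))) < \<infinity>"
  proof -
    define A where "A = 1 - 2 powr - H"
    have A: "0 < A" using H by (simp add: A_def two_powr_minus_less_1)
    have "(SUP t\<in>{0<..1}. ennreal (t powr (- H)) *
            (SUP h\<in>{h. \<bar>h\<bar> \<le> t}. Phi2_norm (shift_ivl h) (\<lambda>s. f (s + h) - f s)))
        \<le> ennreal (1 / A * sqrt 20 * K)"
    proof (rule SUP_least)
      fix t :: real assume "t \<in> {0<..1}"
      then have t: "0 < t" by simp
      have "(SUP h\<in>{h. \<bar>h\<bar> \<le> t}. Phi2_norm (shift_ivl h) (\<lambda>s. f (s + h) - f s))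
          \<le> ennreal (t powr H / A * sqrt 20 * K)"
      proof (rule SUP_least)
        fix h assume "h \<in> {h. \<bar>h\<bar> \<le> t}"
        then have h: "\<bar>h\<bar> \<le> t" by simp
        have "shift_ivl h \<in> sets borel"
          using shift_ivl_pos[of h] shift_ivl_neg[of "- h"] by (cases "0 \<le> h") auto
        then show "Phi2_norm (shift_ivl h) (\<lambda>s. f (s + h) - f s) \<le> ennreal (t powr H / A * sqrt 20 * K)"
          using A t K1 nn_integral_exp_shift_le[OF H cont K K1 t h]
          by (intro Phi2_norm_le_if_exp_integrable) (auto simp: A_def)
      qed
      then have "ennreal (t powr (- H)) *
            (SUP h\<in>{h. \<bar>h\<bar> \<le> t}. Phi2_norm (shift_ivl h) (\<lambda>s. f (s + h) - f s))
          \<le> ennreal (t powr (- H)) * ennreal (t powr H / A * sqrt 20 * K)"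
        by (rule mult_left_mono) simp
      also have "\<dots> = ennreal (1 / A * sqrt 20 * K)"
        using t by (subst ennreal_mult'[symmetric]) (simp_all add: powr_minus field_simps)
      finally show "ennreal (t powr (- H)) *
            (SUP h\<in>{h. \<bar>h\<bar> \<le> t}. Phi2_norm (shift_ivl h) (\<lambda>s. f (s + h) - f s))
          \<le> ennreal (1 / A * sqrt 20 * K)" .
    qed
    then show ?thesis by (simp add: le_less_trans)
  qed
  ultimately show ?thesis by (simp add: besov_orlicz_def)
qed

lemma Phi2_norm_cong:
  assumes "\<And>s. s \<in> J \<Longrightarrow> f s = g s"
  shows "Phi2_norm J f = Phi2_norm J g"
proof -
  have "(\<integral>\<^sup>+x. ennreal (\<bar>f x\<bar> powr p) \<partial>lebesgue_on J) = (\<integral>\<^sup>+x. ennreal (\<bar>g x\<bar> powr p) \<partial>lebesgue_on J)" for p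
    using assms by (intro nn_integral_cong) (simp add: space_restrict_space)
  then show ?thesis by (simp add: Phi2_norm_def Lp_norm_def)
qed

lemma besov_orlicz_cong:
  assumes "f \<in> besov_orlicz \<alpha>" and "\<And>s. s \<in> unit_ivl \<Longrightarrow> f s = g s"
  shows "g \<in> besov_orlicz \<alpha>"
proof -
  have "f \<in> borel_measurable (lebesgue_on unit_ivl) \<longleftrightarrow> g \<in> borel_measurable (lebesgue_on unit_ivl)"
    using assms(2) by (intro measurable_cong) (simp add: space_restrict_space)
  moreover have "Phi2_norm unit_ivl f = Phi2_norm unit_ivl g"
    using assms(2) by (intro Phi2_norm_cong)
  moreover have "Phi2_norm (shift_ivl h) (\<lambda>s. f (s + h) - f s) = Phi2_norm (shift_ivl h) (\<lambda>s. g (s + h) - g s)" for h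
    using assms(2) by (intro Phi2_norm_cong) (simp add: shift_ivl_def)
  ultimately show ?thesis using assms(1) by (simp add: besov_orlicz_def)
qed

section \<open>Paths of subfractional Brownian motion\<close>

theorem theorem3p6:
  fixes M :: "'a measure" and H :: real and S :: "real \<Rightarrow> 'a \<Rightarrow> real"
  assumes "prob_space M"
    and "0 < H" and "H < 1"
    and "subfractional_BM M H S"
  shows "AE \<omega> in M. (\<lambda>t. S t \<omega>) \<in> besov_orlicz H"
proof -
  interpret prob_space M by (rule assms(1))
  obtain X where X: "subfractional_BM M H X" "\<And>t. X t \<in> borel_measurable M"
    "\<And>\<omega>. continuous_on UNIV (\<lambda>t. X t \<omega>)" "AE \<omega> in M. \<forall>t\<ge>0. X t \<omega> = S t \<omega>"
    using continuous_modification[OF assms(4)] by blast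
  from AE_bounded_exp_energy[OF assms(2,3) X(1-3)] X(4) show ?thesis
  proof eventually_elim
    case (elim \<omega>)
    then have "(\<lambda>t. X t \<omega>) \<in> besov_orlicz H"
      using besov_orlicz_if_dyadic[OF assms(2) X(3)] by blast
    then show ?case
      by (rule besov_orlicz_cong) (use elim in \<open>simp add: unit_ivl_def\<close>)
  qed
qed

end
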